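(* Let $\omega$ be a clustering state. There exists a bijection $\mathfrak D^*:\mathcal Q^*_\omega\to\mathcal H^*_\omega$ such that for every $Q^*_\omega\in\mathcal Q^*_\omega$ and every $A\in\mathcal O$, $$Q^*_\omega(A)=\langle\mathfrak D^*(Q^*_\omega),A\rangle^*_\omega.$$ In particular, every $Q^*_\omega$ extends to a continuous linear functional on $\mathcal H^*_\omega$.
   Context: Setting: Fix $D\ge1$, $\mathbb Z^D$ with $\mathrm{dist}(x,y)=\sum_i|x_i-y_i|$, $\mathtt B(n)=\{x:\mathrm{dist}(x,0)\le n\}$. $\mathcal O$ is a complex normed space with distinguished $\mathbf 1$ of norm 1, finite-dimensional subspaces $\mathcal O_X$ ($X$ finite) with $\mathcal O_\emptyset=\mathbb C\mathbf 1$, $X\subset Y\Rightarrow\mathcal O_X\subset\mathcal O_Y$, $\mathcal O_X\cap\mathcal O_Y=\mathcal O_{X\cap Y}$, $\mathcal O=\bigcup_X\mathcal O_X$; $\mathrm{supp}(A)$ smallest $X$ with $A\in\mathcal O_X$, $|A|=|\mathrm{supp}A|$, $\mathrm{dist}(A,B)$ distance of supports ($\mathrm{dist}(A,\mathbf 1)=\infty$). Completion $\mathcal A$ is a unital $C^*$-algebra, $\mathcal O_X$ are $C^*$-subalgebras, disjointly supported elements commute with union support of the product; translations $\iota_x$ are $*$-automorphisms, $\iota_x\iota_y=\iota_{x+y}$, $\mathrm{supp}(\iota_xA)=\mathrm{supp}(A)+x$. Clustering state: translation-invariant state $\omega$ with $\nu:\mathbb N\to\mathbb R^+$, $f:\mathbb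 Z\to\mathbb R^+$, $p>D$, $f(d)\le d^{-p}$ ($d>0$), $|\omega(AB)-\omega(A)\omega(B)|\le\nu(\ell)\|A\|\|B\|f(\mathrm{dist}(A,B))$ for $|A|,|B|<\ell$. Forms: $\langle A,B\rangle_\omega:=\sum_x(\omega(\iota_x(A)^*B)-\omega(A^* )\omega(B))$ and $\langle A,B\rangle^*_\omega:=\langle B^*,A^*\rangle_\omega$; both positive semi-definite. $\mathcal H^*_\omega$ is the Cauchy completion of $\mathcal O$ modulo the null space of $\langle\cdot,\cdot\rangle^*_\omega$ (elements of $\mathcal O$ identified with classes). Pseudolocal sequence $Q=(Q_n)$, $Q_n\in\mathcal O_{\mathtt B(n)}$: $Q'_n:=Q_n-\omega(Q_n)\mathbf 1$ satisfies (I) $\omega(Q_n'^*Q'_n)\le\gamma n^D$ for some $\gamma>0$, all $n>0$; (II) $Q_\omega(A):=\lim_n\omega(Q_n'^*A)$ exists for all $A\in\mathcal O$; (III) for some $0<k<1$, $\lim_n\max_{x,y\in\mathtt B(kn)}|\omega(Q_n'^*\iota_xA)-\omega(Q_n'^*\iota_yA)|=0$ for all $A$. The right pseudolocal charge of $Q$ is the functional $Q^*_\omega$ on $\mathcal O$ defined by $Q^*_\omega(A^* ):=\overline{Q_\omega(A)}$, i.e. $Q^*_\omega(B)=\lim_n(\omega(BQ_n)-\omega(B)\omega(Q_n))$; $\mathcal Q^*_\omega$ is the set of right pseudolocal charges. *)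

theory Defs
  imports "HOL-Analysis.Analysis"
begin

text \<open>Z^D is modelled as int^'d for a finite index type 'd; D = CARD('d) (so D \<ge> 1).\<close>

definition l1dist :: "int^'d \<Rightarrow> int^'d \<Rightarrow> int" where
  "l1dist x y = (\<Sum>i\<in>UNIV. \<bar>x$i - y$i\<bar>)"

definition ballZ :: "real \<Rightarrow> (int^'d) set" where
  "ballZ r = {x. real_of_int (l1dist x 0) \<le> r}"

definition set_dist :: "(int^'d) set \<Rightarrow> (int^'d) set \<Rightarrow> int" where
  "set_dist X Y = Min {l1dist x y | x y. x \<in> X \<and> y \<in> Y}"

text \<open>The type 'a is a real Banach algebra with unit of norm 1; sc is the complex
 scalar multiplication extending the real one and star is the involution.\<close>

definition cstar_algebra :: "(complex \<Rightarrow> 'a::{real_normed_algebra_1,banach} \<Rightarrow> 'a) \<Rightarrow> ('a \<Rightarrow> 'a) \<Rightarrow> bool" where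
  "cstar_algebra sc star \<longleftrightarrow>
     (\<forall>r x. sc (complex_of_real r) x = r *\<^sub>R x) \<and>
     (\<forall>a b x. sc (a * b) x = sc a (sc b x)) \<and>
     (\<forall>a b x. sc (a + b) x = sc a x + sc b x) \<and>
     (\<forall>a x y. sc a (x + y) = sc a x + sc a y) \<and>
     (\<forall>a x y. sc a (x * y) = sc a x * y \<and> sc a (x * y) = x * sc a y) \<and>
     (\<forall>a x. norm (sc a x) = cmod a * norm x) \<and>
     (\<forall>x. star (star x) = x) \<and>
     (\<forall>x y. star (x + y) = star x + star y) \<and>
     (\<forall>a x. star (sc a x) = sc (cnj a) (star x)) \<and>
     (\<forall>x y. star (x * y) = star y * star x) \<and>
     (\<forall>x. norm (star x * x) = (norm x)^2)"

definition fin_dim_csubspace :: "(complex \<Rightarrow> 'a::real_normed_algebra_1 \<Rightarrow> 'a) \<Rightarrow> 'a set \<Rightarrow> bool" where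
  "fin_dim_csubspace sc S \<longleftrightarrow>
     (\<exists>B. finite B \<and> B \<subseteq> S \<and> S = {\<Sum>b\<in>B. sc (c b) b | c. True})"

definition Obs :: "((int^'d) set \<Rightarrow> 'a set) \<Rightarrow> 'a set" where
  "Obs Oloc = (\<Union>{Oloc X | X. finite X})"

definition supp :: "((int^'d) set \<Rightarrow> 'a set) \<Rightarrow> 'a \<Rightarrow> (int^'d) set" where
  "supp Oloc A = (THE X. finite X \<and> A \<in> Oloc X \<and> (\<forall>Y. finite Y \<and> A \<in> Oloc Y \<longrightarrow> X \<subseteq> Y))"

definition lattice_setting ::
  "(complex \<Rightarrow> 'a::{real_normed_algebra_1,banach} \<Rightarrow> 'a) \<Rightarrow> ('a \<Rightarrow> 'a)
   \<Rightarrow> ((int^'d) set \<Rightarrow> 'a set) \<Rightarrow> (int^'d \<Rightarrow> 'a \<Rightarrow> 'a) \<Rightarrow> bool" where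
  "lattice_setting sc star Oloc iota \<longleftrightarrow>
     cstar_algebra sc star \<and>
     \<comment> \<open>O_X finite-dimensional C*-subalgebras\<close>
     (\<forall>X. finite X \<longrightarrow> fin_dim_csubspace sc (Oloc X) \<and> 1 \<in> Oloc X \<and>
        (\<forall>A\<in>Oloc X. \<forall>B\<in>Oloc X. A * B \<in> Oloc X) \<and> (\<forall>A\<in>Oloc X. star A \<in> Oloc X)) \<and>
     Oloc {} = range (\<lambda>c. sc c 1) \<and>
     (\<forall>X Y. finite Y \<longrightarrow> X \<subseteq> Y \<longrightarrow> Oloc X \<subseteq> Oloc Y) \<and>
     (\<forall>X Y. finite X \<longrightarrow> finite Y \<longrightarrow> Oloc X \<inter> Oloc Y = Oloc (X \<inter> Y)) \<and>
     \<comment> \<open>the C*-algebra is the completion of \<O>\<close>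
     closure (Obs Oloc) = UNIV \<and>
     \<comment> \<open>disjointly supported elements commute; support of the product is the union\<close>
     (\<forall>A\<in>Obs Oloc. \<forall>B\<in>Obs Oloc. supp Oloc A \<inter> supp Oloc B = {} \<longrightarrow>
        A * B = B * A \<and> A * B \<in> Oloc (supp Oloc A \<union> supp Oloc B) \<and>
        (A \<noteq> 0 \<and> B \<noteq> 0 \<longrightarrow> supp Oloc (A * B) = supp Oloc A \<union> supp Oloc B)) \<and>
     \<comment> \<open>translations are *-automorphisms forming a group action\<close>
     (\<forall>x. bij (iota x) \<and> iota x 1 = 1 \<and>
        (\<forall>A B. iota x (A + B) = iota x A + iota x B \<and> iota x (A * B) = iota x A * iota x B) \<and>
        (\<forall>c A. iota x (sc c A) = sc c (iota x A)) \<and>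
        (\<forall>A. iota x (star A) = star (iota x A))) \<and>
     (\<forall>x y A. iota x (iota y A) = iota (x + y) A) \<and>
     (\<forall>x. \<forall>A\<in>Obs Oloc. iota x A \<in> Obs Oloc \<and> supp Oloc (iota x A) = (\<lambda>y. y + x) ` supp Oloc A)"

definition is_state :: "(complex \<Rightarrow> 'a::{real_normed_algebra_1,banach} \<Rightarrow> 'a) \<Rightarrow> ('a \<Rightarrow> 'a) \<Rightarrow> ('a \<Rightarrow> complex) \<Rightarrow> bool" where
  "is_state sc star \<omega> \<longleftrightarrow>
     (\<forall>A B. \<omega> (A + B) = \<omega> A + \<omega> B) \<and> (\<forall>c A. \<omega> (sc c A) = c * \<omega> A) \<and>
     (\<forall>A. Im (\<omega> (star A * A)) = 0 \<and> Re (\<omega> (star A * A)) \<ge> 0) \<and> \<omega> 1 = 1"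

definition clustering_state ::
  "(complex \<Rightarrow> 'a::{real_normed_algebra_1,banach} \<Rightarrow> 'a) \<Rightarrow> ('a \<Rightarrow> 'a)
   \<Rightarrow> ((int^'d) set \<Rightarrow> 'a set) \<Rightarrow> (int^'d \<Rightarrow> 'a \<Rightarrow> 'a) \<Rightarrow> ('a \<Rightarrow> complex) \<Rightarrow> bool" where
  "clustering_state sc star Oloc iota \<omega> \<longleftrightarrow>
     is_state sc star \<omega> \<and> (\<forall>x A. \<omega> (iota x A) = \<omega> A) \<and>
     (\<exists>(\<nu>::nat \<Rightarrow> real) (f::int \<Rightarrow> real) (p::real).
        (\<forall>l. \<nu> l > 0) \<and> (\<forall>d. f d > 0) \<and> p > real CARD('d) \<and>
        (\<forall>d>0. f d \<le> real_of_int d powr (- p)) \<and>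
        (\<forall>l. \<forall>A\<in>Obs Oloc. \<forall>B\<in>Obs Oloc.
           card (supp Oloc A) < l \<longrightarrow> card (supp Oloc B) < l \<longrightarrow>
           supp Oloc A \<noteq> {} \<longrightarrow> supp Oloc B \<noteq> {} \<longrightarrow>
           cmod (\<omega> (A * B) - \<omega> A * \<omega> B)
             \<le> \<nu> l * norm A * norm B * f (set_dist (supp Oloc A) (supp Oloc B))))"

definition form :: "('a::{real_normed_algebra_1,banach} \<Rightarrow> 'a) \<Rightarrow> (int^'d \<Rightarrow> 'a \<Rightarrow> 'a) \<Rightarrow> ('a \<Rightarrow> complex)
    \<Rightarrow> 'a \<Rightarrow> 'a \<Rightarrow> complex" where
  "form star iota \<omega> A B = infsum (\<lambda>x. \<omega> (star (iota x A) * B) - \<omega> (star A) * \<omega> B) UNIV"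

definition form_star :: "('a::{real_normed_algebra_1,banach} \<Rightarrow> 'a) \<Rightarrow> (int^'d \<Rightarrow> 'a \<Rightarrow> 'a) \<Rightarrow> ('a \<Rightarrow> complex)
    \<Rightarrow> 'a \<Rightarrow> 'a \<Rightarrow> complex" where
  "form_star star iota \<omega> A B = form star iota \<omega> (star B) (star A)"

definition fcauchy :: "('a \<Rightarrow> 'a \<Rightarrow> complex) \<Rightarrow> 'a::ab_group_add set \<Rightarrow> (nat \<Rightarrow> 'a) \<Rightarrow> bool" where
  "fcauchy fs S0 a \<longleftrightarrow> (\<forall>n. a n \<in> S0) \<and>
     (\<forall>e>0. \<exists>N. \<forall>m\<ge>N. \<forall>n\<ge>N. Re (fs (a m - a n) (a m - a n)) < e)"

definition fequiv :: "('a \<Rightarrow> 'a \<Rightarrow> complex) \<Rightarrow> 'a::ab_group_add set \<Rightarrow> ((nat \<Rightarrow> 'a) \<times> (nat \<Rightarrow> 'a)) set" where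
  "fequiv fs S0 = {(a, b). fcauchy fs S0 a \<and> fcauchy fs S0 b \<and>
     (\<lambda>n. Re (fs (a n - b n) (a n - b n))) \<longlonglongrightarrow> 0}"

definition completion :: "('a \<Rightarrow> 'a \<Rightarrow> complex) \<Rightarrow> 'a::ab_group_add set \<Rightarrow> (nat \<Rightarrow> 'a) set set" where
  "completion fs S0 = {a. fcauchy fs S0 a} // fequiv fs S0"

definition emb :: "('a \<Rightarrow> 'a \<Rightarrow> complex) \<Rightarrow> 'a::ab_group_add set \<Rightarrow> 'a \<Rightarrow> (nat \<Rightarrow> 'a) set" where
  "emb fs S0 A = fequiv fs S0 `` {(\<lambda>_. A)}"

definition hform :: "('a \<Rightarrow> 'a \<Rightarrow> complex) \<Rightarrow> (nat \<Rightarrow> 'a) set \<Rightarrow> 'a \<Rightarrow> complex" where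
  "hform fs h A = lim (\<lambda>n. fs ((SOME a. a \<in> h) n) A)"

definition hnorm :: "('a \<Rightarrow> 'a \<Rightarrow> complex) \<Rightarrow> (nat \<Rightarrow> 'a) set \<Rightarrow> real" where
  "hnorm fs h = lim (\<lambda>n. sqrt (Re (fs ((SOME a. a \<in> h) n) ((SOME a. a \<in> h) n))))"

definition hadd :: "('a \<Rightarrow> 'a \<Rightarrow> complex) \<Rightarrow> 'a::ab_group_add set \<Rightarrow> (nat \<Rightarrow> 'a) set \<Rightarrow> (nat \<Rightarrow> 'a) set \<Rightarrow> (nat \<Rightarrow> 'a) set" where
  "hadd fs S0 h k = fequiv fs S0 `` {(\<lambda>n. (SOME a. a \<in> h) n + (SOME b. b \<in> k) n)}"

definition hscale :: "(complex \<Rightarrow> 'a \<Rightarrow> 'a) \<Rightarrow> ('a \<Rightarrow> 'a \<Rightarrow> complex) \<Rightarrow> 'a::ab_group_add set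
    \<Rightarrow> complex \<Rightarrow> (nat \<Rightarrow> 'a) set \<Rightarrow> (nat \<Rightarrow> 'a) set" where
  "hscale sc fs S0 c h = fequiv fs S0 `` {(\<lambda>n. sc c ((SOME a. a \<in> h) n))}"

definition Hstar ::
  "(complex \<Rightarrow> 'a::{real_normed_algebra_1,banach} \<Rightarrow> 'a) \<Rightarrow> ('a \<Rightarrow> 'a)
   \<Rightarrow> ((int^'d) set \<Rightarrow> 'a set) \<Rightarrow> (int^'d \<Rightarrow> 'a \<Rightarrow> 'a) \<Rightarrow> ('a \<Rightarrow> complex) \<Rightarrow> (nat \<Rightarrow> 'a) set set" where
  "Hstar sc star Oloc iota \<omega> = completion (form_star star iota \<omega>) (Obs Oloc)"

definition centered :: "(complex \<Rightarrow> 'a::{real_normed_algebra_1,banach} \<Rightarrow> 'a) \<Rightarrow> ('a \<Rightarrow> complex) \<Rightarrow> 'a \<Rightarrow> 'a" where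
  "centered sc \<omega> A = A - sc (\<omega> A) 1"

definition pseudolocal ::
  "(complex \<Rightarrow> 'a::{real_normed_algebra_1,banach} \<Rightarrow> 'a) \<Rightarrow> ('a \<Rightarrow> 'a)
   \<Rightarrow> ((int^'d) set \<Rightarrow> 'a set) \<Rightarrow> (int^'d \<Rightarrow> 'a \<Rightarrow> 'a) \<Rightarrow> ('a \<Rightarrow> complex) \<Rightarrow> (nat \<Rightarrow> 'a) \<Rightarrow> bool" where
  "pseudolocal sc star Oloc iota \<omega> Q \<longleftrightarrow>
     (\<forall>n. Q n \<in> Oloc (ballZ (real n))) \<and>
     (\<exists>\<gamma>>0. \<forall>n>0. Re (\<omega> (star (centered sc \<omega> (Q n)) * centered sc \<omega> (Q n)))
                     \<le> \<gamma> * real n ^ CARD('d)) \<and>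
     (\<forall>A\<in>Obs Oloc. convergent (\<lambda>n. \<omega> (star (centered sc \<omega> (Q n)) * A))) \<and>
     (\<exists>k::real. 0 < k \<and> k < 1 \<and>
        (\<forall>A\<in>Obs Oloc.
           (\<lambda>n. Max ((\<lambda>(x, y). cmod (\<omega> (star (centered sc \<omega> (Q n)) * iota x A)
                                     - \<omega> (star (centered sc \<omega> (Q n)) * iota y A)))
                      ` (ballZ (k * real n) \<times> ballZ (k * real n)))) \<longlonglongrightarrow> 0))"

text \<open>Q_\<omega>(A) = lim \<omega>(Q'_n^* A); the right charge is Q^*_\<omega>(B) = conj(Q_\<omega>(B^*)),
  regarded as a functional on \<O> (set to 0 outside \<O>).\<close>
definition charge_star ::
  "(complex \<Rightarrow> 'a::{real_normed_algebra_1,banach} \<Rightarrow> 'a) \<Rightarrow> ('a \<Rightarrow> 'a)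
   \<Rightarrow> ((int^'d) set \<Rightarrow> 'a set) \<Rightarrow> ('a \<Rightarrow> complex) \<Rightarrow> (nat \<Rightarrow> 'a) \<Rightarrow> 'a \<Rightarrow> complex" where
  "charge_star sc star Oloc \<omega> Q B =
     (if B \<in> Obs Oloc then cnj (lim (\<lambda>n. \<omega> (star (centered sc \<omega> (Q n)) * star B))) else 0)"

definition Qstar ::
  "(complex \<Rightarrow> 'a::{real_normed_algebra_1,banach} \<Rightarrow> 'a) \<Rightarrow> ('a \<Rightarrow> 'a)
   \<Rightarrow> ((int^'d) set \<Rightarrow> 'a set) \<Rightarrow> (int^'d \<Rightarrow> 'a \<Rightarrow> 'a) \<Rightarrow> ('a \<Rightarrow> complex) \<Rightarrow> ('a \<Rightarrow> complex) set" where
  "Qstar sc star Oloc iota \<omega> =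
     {charge_star sc star Oloc \<omega> Q | Q. pseudolocal sc star Oloc iota \<omega> Q}"

end

theory Submission
  imports Defs
begin

text \<open>
  Put \<open>cs A B = \<omega> (B A\<^sup>*) - \<omega> B \<omega> (A\<^sup>*)\<close>, a positive Hermitian form invariant under translations. The form
  \<open>\<langle>A, B\<rangle>\<^sup>*\<close> is the lattice sum of \<open>cs A (\<iota>\<^sub>x B)\<close>, absolutely convergent by clustering, and it is also the limit of
  \<open>cs A\<^sub>m B\<^sub>m / |C\<^sub>m|\<close> where \<open>A\<^sub>m\<close> sums the translates of \<open>A\<close> over the cube \<open>C\<^sub>m\<close>; hence it is positive and Hermitian.

  With \<open>R\<^sub>n = Q\<^sub>n\<^sup>*\<close> the right charge is the limit of \<open>cs R\<^sub>n B\<close>. Almost-invariance lets one average \<open>B\<close> over a cube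
  of volume comparable to \<open>n^D\<close>, and Cauchy-Schwarz together with \<open>cs R\<^sub>n R\<^sub>n \<le> \<gamma> n^D\<close> bounds the charge by the
  seminorm of \<open>\<langle>_, _\<rangle>\<^sup>*\<close>; Riesz representation gives its density. Conversely the vector represented by a Cauchy
  sequence \<open>a\<close> is the density of \<open>R\<^sub>n = \<Sum>\<^sub>x \<iota>\<^sub>x a\<^sub>j\<close>, the sum running over a cube of side of order \<open>n\<close>, with
  \<open>j = j(n)\<close> tending to infinity slowly.
\<close>

section \<open>Completion of a semi-inner product space\<close>

text \<open>Cauchy-Schwarz is spent on \<open>cs\<close>, not on the lattice form, because
  pseudolocality controls only \<open>cs R\<^sub>n R\<^sub>n\<close>. The volumes then cancel: this
  variance is at most a constant times the volume, the variance of the block sum of \<open>B\<close>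
  divided by the volume tends to the form at \<open>B\<close>, and averaging divides the squared
  pairing by the squared volume. Both forms are instances of the locale below, \<open>cs\<close> on
  the whole algebra and the lattice form on local observables. The obstacle in the converse is that
  the clustering constant depends on the size of supports, so nothing is uniform along a Cauchy
  sequence whose supports may grow: each fixed term behaves well only from some unknown
  \<open>n\<close> on. This forces the slow choice of \<open>j\<close>. Inside one finite local
  algebra supports have bounded cardinality, which gives uniformity in the second argument; it also
  requires that translations do not increase the norm of a local observable, a fact derived from the
  C*-identity.\<close>

locale semi_inner =
  fixes sc :: "complex \<Rightarrow> 'a::ab_group_add \<Rightarrow> 'a" and S :: "'a set" and fs :: "'a \<Rightarrow> 'a \<Rightarrow> complex"
  assumes zero_mem: "0 \<in> S"
    and add_mem: "A \<in> S \<Longrightarrow> B \<in> S \<Longrightarrow> A + B \<in> S"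
    and sc_mem: "A \<in> S \<Longrightarrow> sc c A \<in> S"
    and sc_minus1: "sc (-1) A = - A"
    and add_right: "A \<in> S \<Longrightarrow> B \<in> S \<Longrightarrow> C \<in> S \<Longrightarrow> fs A (B + C) = fs A B + fs A C"
    and sc_right: "A \<in> S \<Longrightarrow> B \<in> S \<Longrightarrow> fs A (sc c B) = c * fs A B"
    and herm: "A \<in> S \<Longrightarrow> B \<in> S \<Longrightarrow> fs B A = cnj (fs A B)"
    and pos: "A \<in> S \<Longrightarrow> Re (fs A A) \<ge> 0"
begin

section \<open>Cauchy-Schwarz and the seminorm\<close>

definition sn :: "'a \<Rightarrow> real" where "sn A = sqrt (Re (fs A A))"

lemma minus_mem: "A \<in> S \<Longrightarrow> - A \<in> S"
  using sc_mem[of A "-1"] sc_minus1 by simp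

lemma diff_mem: "A \<in> S \<Longrightarrow> B \<in> S \<Longrightarrow> A - B \<in> S"
  using add_mem[of A "- B"] minus_mem[of B] by simp

lemma minus_right: "A \<in> S \<Longrightarrow> B \<in> S \<Longrightarrow> fs A (- B) = - fs A B"
  using sc_right[of A B "-1"] sc_minus1 by simp

lemma diff_right: "A \<in> S \<Longrightarrow> B \<in> S \<Longrightarrow> C \<in> S \<Longrightarrow> fs A (B - C) = fs A B - fs A C"
  using add_right[of A B "- C"] minus_mem[of C] minus_right by simp

lemma zero_right: "A \<in> S \<Longrightarrow> fs A 0 = 0"
  using diff_right[of A 0 0] zero_mem by simp

lemma add_left: "A \<in> S \<Longrightarrow> B \<in> S \<Longrightarrow> C \<in> S \<Longrightarrow> fs (A + B) C = fs A C + fs B C"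
  using add_right[of C A B] herm add_mem by (metis complex_cnj_add)

lemma diff_left: "A \<in> S \<Longrightarrow> B \<in> S \<Longrightarrow> C \<in> S \<Longrightarrow> fs (A - B) C = fs A C - fs B C"
  using diff_right[of C A B] herm diff_mem by (metis complex_cnj_diff)

lemma sc_left: "A \<in> S \<Longrightarrow> B \<in> S \<Longrightarrow> fs (sc c A) B = cnj c * fs A B"
  using sc_right[of B A c] herm sc_mem by (metis complex_cnj_mult)

lemma sum_mem: "(\<And>i. i \<in> I \<Longrightarrow> g i \<in> S) \<Longrightarrow> (\<Sum>i\<in>I. g i) \<in> S"
  by (induction I rule: infinite_finite_induct) (auto simp: zero_mem add_mem)

lemma sum_right: "A \<in> S \<Longrightarrow> (\<And>i. i \<in> I \<Longrightarrow> g i \<in> S) \<Longrightarrow> fs A (\<Sum>i\<in>I. g i) = (\<Sum>i\<in>I. fs A (g i))"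
  by (induction I rule: infinite_finite_induct) (auto simp: zero_right add_right sum_mem)

lemma sum_left: "A \<in> S \<Longrightarrow> (\<And>i. i \<in> I \<Longrightarrow> g i \<in> S) \<Longrightarrow> fs (\<Sum>i\<in>I. g i) A = (\<Sum>i\<in>I. fs (g i) A)"
  using sum_right[of A I g] herm[of A "\<Sum>i\<in>I. g i"] sum_mem[of I g] herm[of A]
  by (simp add: cnj_sum)

text \<open>The scalar stays complex so that its phase can be chosen afterwards, turning the real
  part of the cross term into a modulus. Both Cauchy-Schwarz and the perturbations in
  \<open>Riesz\<close> rest on it.\<close>

lemma Re_fs_plus:
  assumes "A \<in> S" "B \<in> S"
  shows "Re (fs (A + sc c B) (A + sc c B)) = Re (fs A A) + 2 * Re (c * fs A B) + (cmod c)\<^sup>2 * Re (fs B B)"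
proof -
  have "Im (fs B B) = 0" using herm[OF assms(2) assms(2)] by (metis cnj.simps(2) neg_equal_zero)
  then have "Re (cnj c * (c * fs B B)) = (cmod c)\<^sup>2 * Re (fs B B)"
    by (simp add: cmod_power2) (simp add: algebra_simps power2_eq_square)
  moreover have "Re (cnj c * fs B A) = Re (c * fs A B)"
    using herm[OF assms] by simp
  ultimately show ?thesis
    using assms by (simp add: add_left add_right sc_left sc_right add_mem sc_mem algebra_simps)
qed

lemma Cauchy_Schwarz_sq:
  assumes A: "A \<in> S" and B: "B \<in> S"
  shows "(cmod (fs A B))\<^sup>2 \<le> Re (fs A A) * Re (fs B B)"
proof -
  define f a b where "f = (cmod (fs A B))\<^sup>2" and "a = Re (fs A A)" and "b = Re (fs B B)"
  \<comment> \<open>The scalar \<open>- t * cnj (fs A B)\<close> makes the cross term real and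
    leaves a real quadratic in \<open>t\<close>.\<close>
  have ineq: "0 \<le> a - 2 * t * f + t\<^sup>2 * f * b" for t :: real
  proof -
    have "Re (- of_real t * cnj (fs A B) * fs A B) = - t * f"
      by (simp add: f_def cmod_power2) (simp add: power2_eq_square algebra_simps)
    moreover have "(cmod (- of_real t * cnj (fs A B)))\<^sup>2 = t\<^sup>2 * f"
      by (simp add: f_def norm_mult power_mult_distrib)
    ultimately show ?thesis
      using Re_fs_plus[OF A B, of "- of_real t * cnj (fs A B)"] pos[OF add_mem[OF A sc_mem[OF B]]]
      unfolding a_def b_def by (metis (no_types, lifting) add.commute add_uminus_conv_diff mult.assoc mult_minus_left mult_minus_right)
  qed
  have a0: "a \<ge> 0" and b0: "b \<ge> 0" using pos A B by (auto simp: a_def b_def)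
  show ?thesis
  proof (cases "b = 0")
    case True
    show ?thesis
    proof (cases "f = 0")
      case True then show ?thesis using a0 b0 by (simp add: f_def a_def b_def)
    next
      case False
      \<comment> \<open>With \<open>b = 0\<close> the quadratic is affine in \<open>t\<close>, and
        at this \<open>t\<close> it equals -1.\<close>
      then have "2 * ((a + 1) / (2 * f)) * f = a + 1" by simp
      then show ?thesis using ineq[of "(a + 1) / (2 * f)"] True by simp
    qed
  next
    case False
    \<comment> \<open>\<open>t = 1/b\<close> minimises the quadratic.\<close>
    then have "2 * (1/b) * f = 2 * (f / b)" "(1/b)\<^sup>2 * f * b = f / b" by (auto simp: power2_eq_square)
    then have "f / b \<le> a" using ineq[of "1/b"] by simp
    then show ?thesis using False b0 by (simp add: divide_le_eq f_def a_def b_def)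
  qed
qed

lemma Cauchy_Schwarz: "A \<in> S \<Longrightarrow> B \<in> S \<Longrightarrow> cmod (fs A B) \<le> sn A * sn B"
  unfolding sn_def using Cauchy_Schwarz_sq by (simp add: real_le_rsqrt flip: real_sqrt_mult)

lemma sn_ge0: "A \<in> S \<Longrightarrow> sn A \<ge> 0"
  by (simp add: sn_def pos)

lemma sn_sq: "A \<in> S \<Longrightarrow> (sn A)\<^sup>2 = Re (fs A A)"
  by (simp add: sn_def pos)

lemma sn_sc: "A \<in> S \<Longrightarrow> sn (sc c A) = cmod c * sn A"
proof -
  assume A: "A \<in> S"
  have "fs (sc c A) (sc c A) = of_real ((cmod c)\<^sup>2) * fs A A"
    using A by (simp add: sc_left sc_right sc_mem complex_norm_square mult.commute del: of_real_power)
  then show ?thesis by (simp add: sn_def real_sqrt_mult)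
qed

lemma sn_minus: "A \<in> S \<Longrightarrow> sn (- A) = sn A"
  using sn_sc[of A "-1"] sc_minus1 by simp

lemma sn_triangle:
  assumes "A \<in> S" "B \<in> S"
  shows "sn (A + B) \<le> sn A + sn B"
proof -
  have "Re (fs (A + B) (A + B)) = Re (fs A A) + 2 * Re (fs A B) + Re (fs B B)"
    using assms herm[OF assms] by (simp add: add_left add_right add_mem)
  also have "\<dots> \<le> (sn A)\<^sup>2 + 2 * (sn A * sn B) + (sn B)\<^sup>2"
    using Cauchy_Schwarz[OF assms] complex_Re_le_cmod[of "fs A B"] assms by (simp add: sn_sq)
  also have "\<dots> = (sn A + sn B)\<^sup>2" by (simp add: power2_sum)
  finally show ?thesis
    unfolding sn_def[of "A + B"] using sn_ge0 assms by (simp add: real_le_lsqrt real_sqrt_le_iff)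
qed

lemma sn_triangle_diff: "A \<in> S \<Longrightarrow> B \<in> S \<Longrightarrow> \<bar>sn A - sn B\<bar> \<le> sn (A - B)"
  using sn_triangle[of "A - B" B] sn_triangle[of "B - A" A] sn_minus[of "A - B"] diff_mem by fastforce

lemma sn_commute: "A \<in> S \<Longrightarrow> B \<in> S \<Longrightarrow> sn (A - B) = sn (B - A)"
  using sn_minus[of "A - B"] diff_mem by simp

section \<open>Cauchy sequences and their classes\<close>

lemma sn_small_iff: "A \<in> S \<Longrightarrow> e > 0 \<Longrightarrow> Re (fs A A) < e\<^sup>2 \<longleftrightarrow> sn A < e"
  using sn_sq[of A] sn_ge0[of A] by (metis abs_of_nonneg less_eq_real_def power2_less_imp_less power_strict_mono pos2)

text \<open>The definition measures differences by \<open>fs\<close>, the square of the seminorm;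
  after taking roots the triangle inequality applies.\<close>

lemma fcauchy_iff:
  "fcauchy fs S a \<longleftrightarrow> (\<forall>n. a n \<in> S) \<and> (\<forall>e>0. \<exists>N. \<forall>m\<ge>N. \<forall>n\<ge>N. sn (a m - a n) < e)"
proof (cases "\<forall>n. a n \<in> S")
  case True
  then have D: "a m - a n \<in> S" for m n by (simp add: diff_mem)
  show ?thesis
  proof
    assume c: "fcauchy fs S a"
    show "(\<forall>n. a n \<in> S) \<and> (\<forall>e>0. \<exists>N. \<forall>m\<ge>N. \<forall>n\<ge>N. sn (a m - a n) < e)"
    proof (intro conjI True allI impI)
      fix e :: real assume e: "e > 0"
      then obtain N where "\<forall>m\<ge>N. \<forall>n\<ge>N. Re (fs (a m - a n) (a m - a n)) < e\<^sup>2"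
        using c zero_less_power[OF e, of 2] unfolding fcauchy_def by blast
      then show "\<exists>N. \<forall>m\<ge>N. \<forall>n\<ge>N. sn (a m - a n) < e" using sn_small_iff[OF D e] by blast
    qed
  next
    assume c: "(\<forall>n. a n \<in> S) \<and> (\<forall>e>0. \<exists>N. \<forall>m\<ge>N. \<forall>n\<ge>N. sn (a m - a n) < e)"
    show "fcauchy fs S a" unfolding fcauchy_def
    proof (intro conjI True allI impI)
      fix e :: real assume e: "e > 0"
      then obtain N where N: "\<forall>m\<ge>N. \<forall>n\<ge>N. sn (a m - a n) < sqrt e"
        using c by (meson real_sqrt_gt_zero)
      have "Re (fs (a m - a n) (a m - a n)) < e" if "m \<ge> N" "n \<ge> N" for m n
        using N sn_small_iff[OF D, of "sqrt e" m n] that e by auto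
      then show "\<exists>N. \<forall>m\<ge>N. \<forall>n\<ge>N. Re (fs (a m - a n) (a m - a n)) < e" by blast
    qed
  qed
qed (auto simp: fcauchy_def)

lemma fequiv_iff:
  "(a, b) \<in> fequiv fs S \<longleftrightarrow> fcauchy fs S a \<and> fcauchy fs S b \<and> (\<lambda>n. sn (a n - b n)) \<longlonglongrightarrow> 0"
proof -
  have "(\<lambda>n. Re (fs (a n - b n) (a n - b n))) \<longlonglongrightarrow> 0 \<longleftrightarrow> (\<lambda>n. sn (a n - b n)) \<longlonglongrightarrow> 0"
    if "\<forall>n. a n \<in> S" "\<forall>n. b n \<in> S"
  proof
    assume "(\<lambda>n. Re (fs (a n - b n) (a n - b n))) \<longlonglongrightarrow> 0"
    from tendsto_real_sqrt[OF this] show "(\<lambda>n. sn (a n - b n)) \<longlonglongrightarrow> 0" by (simp add: sn_def)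
  next
    assume "(\<lambda>n. sn (a n - b n)) \<longlonglongrightarrow> 0"
    from tendsto_power[OF this, of 2] that show "(\<lambda>n. Re (fs (a n - b n) (a n - b n))) \<longlonglongrightarrow> 0"
      by (simp add: sn_sq diff_mem)
  qed
  then show ?thesis by (auto simp: fequiv_def fcauchy_def)
qed

lemma fequiv_equiv: "equiv {a. fcauchy fs S a} (fequiv fs S)"
proof (rule equivI)
  show "fequiv fs S \<subseteq> {a. fcauchy fs S a} \<times> {a. fcauchy fs S a}" by (auto simp: fequiv_def)
  show "refl_on {a. fcauchy fs S a} (fequiv fs S)"
    by (auto simp: refl_on_def fequiv_def zero_right zero_mem)
  show "sym (fequiv fs S)"
    by (auto simp: sym_def fequiv_iff fcauchy_def sn_commute)
  show "trans (fequiv fs S)"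
  proof (rule transI)
    fix a b c assume ab: "(a, b) \<in> fequiv fs S" and bc: "(b, c) \<in> fequiv fs S"
    have mem: "a n \<in> S" "b n \<in> S" "c n \<in> S" for n using ab bc by (auto simp: fequiv_def fcauchy_def)
    have "(\<lambda>n. sn (a n - b n) + sn (b n - c n)) \<longlonglongrightarrow> 0 + 0"
      using ab bc by (intro tendsto_add) (auto simp: fequiv_iff)
    then have lim: "(\<lambda>n. sn (a n - b n) + sn (b n - c n)) \<longlonglongrightarrow> 0" by simp
    have "(\<lambda>n. sn (a n - c n)) \<longlonglongrightarrow> 0"
    proof (rule tendsto_sandwich[OF _ _ tendsto_const lim])
      show "\<forall>\<^sub>F n in sequentially. 0 \<le> sn (a n - c n)" using mem by (simp add: sn_ge0 diff_mem)
      show "\<forall>\<^sub>F n in sequentially. sn (a n - c n) \<le> sn (a n - b n) + sn (b n - c n)"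
      proof (intro always_eventually allI)
        fix n
        have "sn ((a n - b n) + (b n - c n)) \<le> sn (a n - b n) + sn (b n - c n)"
          by (intro sn_triangle diff_mem mem)
        then show "sn (a n - c n) \<le> sn (a n - b n) + sn (b n - c n)" by simp
      qed
    qed
    then show "(a, c) \<in> fequiv fs S" using ab bc by (auto simp: fequiv_iff)
  qed
qed

text \<open>The choice made inside \<open>hform\<close>, \<open>hnorm\<close>, \<open>hadd\<close>
  and \<open>hscale\<close>, named so that facts about it can be stated.\<close>

definition rep :: "(nat \<Rightarrow> 'a) set \<Rightarrow> nat \<Rightarrow> 'a" where "rep h = (SOME a. a \<in> h)"

lemma rep_class: "fcauchy fs S a \<Longrightarrow> (a, rep (fequiv fs S `` {a})) \<in> fequiv fs S"
  unfolding rep_def by (rule someI2[of _ a]) (use equiv_class_self[OF fequiv_equiv, of a] in auto)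

lemma rep_mem:
  assumes "h \<in> completion fs S"
  shows "fcauchy fs S (rep h)" "h = fequiv fs S `` {rep h}"
proof -
  obtain a where a: "fcauchy fs S a" "h = fequiv fs S `` {a}"
    using assms unfolding completion_def by (auto elim: quotientE)
  then have r: "(a, rep h) \<in> fequiv fs S" using rep_class by simp
  then show "fcauchy fs S (rep h)" by (simp add: fequiv_iff)
  show "h = fequiv fs S `` {rep h}" using a(2) equiv_class_eq[OF fequiv_equiv r] by simp
qed

lemma class_mem_completion: "fcauchy fs S a \<Longrightarrow> fequiv fs S `` {a} \<in> completion fs S"
  unfolding completion_def by (rule quotientI) simp

lemma fcauchy_bounded:
  assumes "fcauchy fs S a"
  obtains M where "\<And>n. sn (a n) \<le> M" "M > 0"
proof -
  obtain N where N: "\<forall>m\<ge>N. \<forall>n\<ge>N. sn (a m - a n) < 1" and mem: "\<And>n. a n \<in> S"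
    using assms unfolding fcauchy_iff by (metis zero_less_one)
  define M where "M = (\<Sum>n\<le>N. sn (a n)) + 1"
  have "sn (a n) \<le> M" for n
  proof (cases "n \<le> N")
    case True
    then have "sn (a n) \<le> (\<Sum>n\<le>N. sn (a n))"
      by (intro member_le_sum) (auto simp: sn_ge0 mem)
    then show ?thesis by (simp add: M_def)
  next
    case False
    then have "sn (a n) \<le> sn (a N) + 1" using N sn_triangle_diff[OF mem[of n] mem[of N]]
      by (smt (verit) nat_le_linear)
    moreover have "sn (a N) \<le> (\<Sum>n\<le>N. sn (a n))"
      by (intro member_le_sum) (auto simp: sn_ge0 mem)
    ultimately show ?thesis by (simp add: M_def)
  qed
  moreover have "M > 0" unfolding M_def by (intro add_nonneg_pos sum_nonneg) (auto simp: sn_ge0 mem)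
  ultimately show ?thesis using that by blast
qed

text \<open>The bound makes \<open>q\<close> vanish on the null space of the form, so
  \<open>q\<close> depends only on classes and extends to the completion.\<close>

definition bounded_functional :: "('a \<Rightarrow> complex) \<Rightarrow> real \<Rightarrow> bool" where
  "bounded_functional q C \<longleftrightarrow> (\<forall>A\<in>S. \<forall>B\<in>S. q (A + B) = q A + q B) \<and> (\<forall>c. \<forall>A\<in>S. q (sc c A) = c * q A) \<and>
     (\<forall>A\<in>S. cmod (q A) \<le> C * sn A)"

lemma bounded_functional_diff:
  assumes "bounded_functional q C" "A \<in> S" "B \<in> S"
  shows "q (A - B) = q A - q B"
proof -
  have "q (A + sc (-1) B) = q A + (-1) * q B"
    using assms sc_mem[of B "-1"] unfolding bounded_functional_def by metis
  then show ?thesis by (simp add: sc_minus1)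
qed

lemma bounded_functional_convergent:
  assumes q: "bounded_functional q C" and a: "fcauchy fs S a"
  shows "convergent (\<lambda>n. q (a n))"
proof -
  have mem: "a n \<in> S" for n using a by (simp add: fcauchy_def)
  have "Cauchy (\<lambda>n. q (a n))"
  proof (rule CauchyI)
    fix e :: real assume e: "e > 0"
    \<comment> \<open>\<open>C\<close> may be zero, or negative when the seminorm vanishes;
      \<open>\<bar>C\<bar> + 1\<close> is a safe divisor.\<close>
    then have "e / (\<bar>C\<bar> + 1) > 0" by simp
    then obtain N where N: "\<forall>m\<ge>N. \<forall>n\<ge>N. sn (a m - a n) < e / (\<bar>C\<bar> + 1)"
      using a unfolding fcauchy_iff by blast
    have "cmod (q (a m) - q (a n)) < e" if "m \<ge> N" "n \<ge> N" for m n
    proof -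
      have "cmod (q (a m) - q (a n)) \<le> C * sn (a m - a n)"
        using bounded_functional_diff[OF q mem mem] q diff_mem[OF mem mem] unfolding bounded_functional_def by metis
      also have "\<dots> \<le> (\<bar>C\<bar> + 1) * sn (a m - a n)"
        using sn_ge0[OF diff_mem[OF mem mem]] by (intro mult_right_mono) auto
      also have "\<dots> < e" using N that pos_less_divide_eq[of "\<bar>C\<bar> + 1" _ e] by (simp add: mult.commute)
      finally show ?thesis .
    qed
    then show "\<exists>N. \<forall>m\<ge>N. \<forall>n\<ge>N. norm (q (a m) - q (a n)) < e" by blast
  qed
  then show ?thesis by (simp add: Cauchy_convergent)
qed

lemma bounded_functional_fequiv:
  assumes q: "bounded_functional q C" and ab: "(a, b) \<in> fequiv fs S"
  shows "lim (\<lambda>n. q (a n)) = lim (\<lambda>n. q (b n))"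
proof -
  have mem: "a n \<in> S" "b n \<in> S" for n using ab by (auto simp: fequiv_def fcauchy_def)
  have "(\<lambda>n. q (a n) - q (b n)) \<longlonglongrightarrow> 0"
  proof (rule Lim_null_comparison)
    show "\<forall>\<^sub>F n in sequentially. cmod (q (a n) - q (b n)) \<le> C * sn (a n - b n)"
    proof (intro always_eventually allI)
      fix n
      show "cmod (q (a n) - q (b n)) \<le> C * sn (a n - b n)"
        using bounded_functional_diff[OF q mem, of n n] q diff_mem[OF mem, of n n] unfolding bounded_functional_def by metis
    qed
    show "(\<lambda>n. C * sn (a n - b n)) \<longlonglongrightarrow> 0"
      using ab tendsto_mult_right_zero by (auto simp: fequiv_iff)
  qed
  moreover have "(\<lambda>n. q (b n)) \<longlonglongrightarrow> lim (\<lambda>n. q (b n))"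
    using bounded_functional_convergent[OF q] ab by (simp add: fequiv_iff convergent_LIMSEQ_iff)
  ultimately have "(\<lambda>n. (q (a n) - q (b n)) + q (b n)) \<longlonglongrightarrow> 0 + lim (\<lambda>n. q (b n))"
    by (rule tendsto_add)
  then show ?thesis by (intro limI) simp
qed

lemma bounded_functional_fs:
  "B \<in> S \<Longrightarrow> bounded_functional (\<lambda>A. fs B A) (sn B)"
  by (auto simp: bounded_functional_def add_right sc_right Cauchy_Schwarz)

lemma fs_convergent:
  assumes a: "fcauchy fs S a" and B: "B \<in> S"
  shows "convergent (\<lambda>n. fs (a n) B)"
proof -
  have "convergent (\<lambda>n. fs B (a n))" by (rule bounded_functional_convergent[OF bounded_functional_fs[OF B] a])
  then obtain l where "(\<lambda>n. fs B (a n)) \<longlonglongrightarrow> l" by (auto simp: convergent_def)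
  then have "(\<lambda>n. cnj (fs B (a n))) \<longlonglongrightarrow> cnj l" by (rule tendsto_cnj)
  then show ?thesis using a B by (auto simp: convergent_def fcauchy_def herm[of B])
qed

lemma hform_tendsto:
  assumes "h \<in> completion fs S" "B \<in> S"
  shows "(\<lambda>n. fs (rep h n) B) \<longlonglongrightarrow> hform fs h B"
  using fs_convergent[OF rep_mem(1)[OF assms(1)] assms(2)]
  unfolding hform_def rep_def by (simp add: convergent_LIMSEQ_iff)

text \<open>Frees \<open>hform\<close> from the chosen representative: replacing \<open>b n\<close>
  by an equivalent \<open>a n\<close> changes the pairing with \<open>B\<close> by at most
  \<open>sn (a n - b n) * sn B\<close>.\<close>

lemma hform_class:
  assumes a: "fcauchy fs S a" and B: "B \<in> S"
  shows "(\<lambda>n. fs (a n) B) \<longlonglongrightarrow> hform fs (fequiv fs S `` {a}) B"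
proof -
  define b where "b = rep (fequiv fs S `` {a})"
  have ab: "(a, b) \<in> fequiv fs S" using rep_class[OF a] by (simp add: b_def)
  have mem: "a n \<in> S" "b n \<in> S" for n using ab by (auto simp: fequiv_def fcauchy_def)
  have "(\<lambda>n. fs (a n) B - fs (b n) B) \<longlonglongrightarrow> 0"
  proof (rule Lim_null_comparison)
    show "\<forall>\<^sub>F n in sequentially. cmod (fs (a n) B - fs (b n) B) \<le> sn (a n - b n) * sn B"
      using Cauchy_Schwarz[OF diff_mem[OF mem] B] by (simp add: diff_left mem B)
    show "(\<lambda>n. sn (a n - b n) * sn B) \<longlonglongrightarrow> 0"
      using ab tendsto_mult_left_zero by (auto simp: fequiv_iff)
  qed
  moreover have "(\<lambda>n. fs (b n) B) \<longlonglongrightarrow> hform fs (fequiv fs S `` {a}) B"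
    unfolding b_def by (rule hform_tendsto[OF class_mem_completion[OF a] B])
  ultimately have "(\<lambda>n. (fs (a n) B - fs (b n) B) + fs (b n) B) \<longlonglongrightarrow> 0 + hform fs (fequiv fs S `` {a}) B"
    by (rule tendsto_add)
  then show ?thesis by simp
qed

text \<open>The difference \<open>c\<close> of two representatives is Cauchy and pairs to 0 in the
  limit with every fixed element. Splitting \<open>fs (c n) (c n)\<close> into the pairings with
  \<open>c n - c N\<close> and with the fixed \<open>c N\<close> makes the first part small by
  boundedness and the Cauchy property, the second by weak convergence.\<close>

lemma hform_inj:
  assumes h: "h \<in> completion fs S" and k: "k \<in> completion fs S"
    and eq: "\<And>B. B \<in> S \<Longrightarrow> hform fs h B = hform fs k B"
  shows "h = k"
proof -
  define c where "c n = rep h n - rep k n" for n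
  have fh: "fcauchy fs S (rep h)" and fk: "fcauchy fs S (rep k)" using rep_mem h k by auto
  have mem: "rep h n \<in> S" "rep k n \<in> S" for n using fh fk by (auto simp: fcauchy_def)
  have cm: "c n \<in> S" for n by (simp add: c_def diff_mem mem)
  obtain M1 M2 where M1: "\<And>n. sn (rep h n) \<le> M1" "M1 > 0" and M2: "\<And>n. sn (rep k n) \<le> M2" "M2 > 0"
    using fcauchy_bounded[OF fh] fcauchy_bounded[OF fk] by metis
  define M where "M = M1 + M2"
  have M: "sn (c n) \<le> M" "M > 0" for n
  proof -
    have "sn (c n) \<le> sn (rep h n) + sn (- rep k n)"
      unfolding c_def using sn_triangle[OF mem(1) minus_mem[OF mem(2)], of n n] by simp
    then show "sn (c n) \<le> M" using M1(1)[of n] M2(1)[of n] by (simp add: M_def sn_minus mem)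
    show "M > 0" using M1 M2 by (simp add: M_def)
  qed
  have z: "(\<lambda>n. fs (c n) B) \<longlonglongrightarrow> 0" if "B \<in> S" for B
    using tendsto_diff[OF hform_tendsto[OF h that] hform_tendsto[OF k that]] eq[OF that]
    by (simp add: c_def diff_left mem that)
  have "(\<lambda>n. Re (fs (c n) (c n))) \<longlonglongrightarrow> 0"
  proof (rule LIMSEQ_I)
    fix r :: real assume r: "r > 0"
    \<comment> \<open>Each representative contributes \<open>e\<close> to
      \<open>sn (c n - c N)\<close>, so the first part is at most
      \<open>M * (2 * e) = r / 2\<close>.\<close>
    define e where "e = r / (4 * M)"
    have e: "e > 0" using r M by (simp add: e_def)
    obtain N1 where N1: "\<forall>m\<ge>N1. \<forall>n\<ge>N1. sn (rep h m - rep h n) < e" using fh e unfolding fcauchy_iff by blast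
    obtain N2 where N2: "\<forall>m\<ge>N2. \<forall>n\<ge>N2. sn (rep k m - rep k n) < e" using fk e unfolding fcauchy_iff by blast
    define N where "N = max N1 N2"
    obtain N3 where N3: "\<And>n. n \<ge> N3 \<Longrightarrow> cmod (fs (c n) (c N)) < r / 2"
      using LIMSEQ_D[OF z[OF cm[of N]], of "r/2"] r by auto
    have "norm (Re (fs (c n) (c n)) - 0) < r" if n: "n \<ge> max N N3" for n
    proof -
      have "c n - c N = (rep h n - rep h N) + (- (rep k n - rep k N))" by (simp add: c_def)
      then have "sn (c n - c N) \<le> sn (rep h n - rep h N) + sn (- (rep k n - rep k N))"
        using sn_triangle diff_mem mem minus_mem by metis
      also have "\<dots> < e + e" using N1 N2 n by (intro add_strict_mono) (auto simp: sn_minus diff_mem mem N_def sn_commute)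
      finally have d: "sn (c n - c N) < 2 * e" by simp
      have "fs (c n) (c n) = fs (c n) (c n - c N) + fs (c n) (c N)" by (simp add: diff_right cm)
      then have "cmod (fs (c n) (c n)) \<le> cmod (fs (c n) (c n - c N)) + cmod (fs (c n) (c N))"
        by (metis norm_triangle_ineq)
      also have "cmod (fs (c n) (c n - c N)) \<le> sn (c n) * sn (c n - c N)"
        by (simp add: Cauchy_Schwarz cm diff_mem)
      also have "\<dots> \<le> M * (2 * e)" using M d sn_ge0 cm diff_mem by (intro mult_mono) auto
      also have "\<dots> = r / 2" using M by (simp add: e_def)
      finally have "cmod (fs (c n) (c n)) < r" using N3[of n] n by simp
      then show ?thesis using abs_Re_le_cmod[of "fs (c n) (c n)"] by simp
    qed
    then show "\<exists>no. \<forall>n\<ge>no. norm (Re (fs (c n) (c n)) - 0) < r" by blast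
  qed
  then have "(rep h, rep k) \<in> fequiv fs S" using fh fk by (simp add: fequiv_def c_def)
  then show ?thesis using rep_mem(2)[OF h] rep_mem(2)[OF k] equiv_class_eq[OF fequiv_equiv] by metis
qed

section \<open>Linear structure and norm on classes, continuous extension\<close>

lemma fcauchy_add:
  assumes "fcauchy fs S a" "fcauchy fs S b"
  shows "fcauchy fs S (\<lambda>n. a n + b n)"
  unfolding fcauchy_iff
proof (intro conjI allI impI)
  have mem: "a n \<in> S" "b n \<in> S" for n using assms by (auto simp: fcauchy_def)
  then show "a n + b n \<in> S" for n by (simp add: add_mem)
  fix e :: real assume "e > 0"
  then have e: "e / 2 > 0" by simp
  obtain N1 where N1: "\<forall>m\<ge>N1. \<forall>n\<ge>N1. sn (a m - a n) < e / 2" using assms(1) e unfolding fcauchy_iff by blast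
  obtain N2 where N2: "\<forall>m\<ge>N2. \<forall>n\<ge>N2. sn (b m - b n) < e / 2" using assms(2) e unfolding fcauchy_iff by blast
  have "sn ((a m + b m) - (a n + b n)) < e" if "m \<ge> max N1 N2" "n \<ge> max N1 N2" for m n
  proof -
    have "(a m + b m) - (a n + b n) = (a m - a n) + (b m - b n)" by simp
    then have "sn ((a m + b m) - (a n + b n)) \<le> sn (a m - a n) + sn (b m - b n)"
      using sn_triangle diff_mem mem by metis
    also have "\<dots> < e / 2 + e / 2" using that N1 N2 by (intro add_strict_mono) auto
    finally show ?thesis by simp
  qed
  then show "\<exists>N. \<forall>m\<ge>N. \<forall>n\<ge>N. sn ((a m + b m) - (a n + b n)) < e" by blast
qed

text \<open>Additivity of \<open>sc c\<close> is not part of the locale, so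
  \<open>sc c A - sc c B\<close> cannot be rewritten as \<open>sc c (A - B)\<close>; the seminorms
  are compared by expanding the form instead.\<close>

lemma sn_sc_diff:
  assumes "A \<in> S" "B \<in> S"
  shows "sn (sc c A - sc c B) = cmod c * sn (A - B)"
proof -
  have "fs (sc c A - sc c B) (sc c A - sc c B) = of_real ((cmod c)\<^sup>2) * fs (A - B) (A - B)"
    unfolding complex_norm_square using assms
    by (simp add: diff_left diff_right sc_left sc_right sc_mem diff_mem algebra_simps)
  then show ?thesis by (simp add: sn_def real_sqrt_mult)
qed

lemma fcauchy_sc:
  assumes "fcauchy fs S a"
  shows "fcauchy fs S (\<lambda>n. sc c (a n))"
  unfolding fcauchy_iff
proof (intro conjI allI impI)
  have mem: "a n \<in> S" for n using assms by (auto simp: fcauchy_def)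
  then show "sc c (a n) \<in> S" for n by (simp add: sc_mem)
  fix e :: real assume "e > 0"
  then have e: "e / (cmod c + 1) > 0" by (simp add: add_nonneg_pos)
  obtain N where N: "\<forall>m\<ge>N. \<forall>n\<ge>N. sn (a m - a n) < e / (cmod c + 1)" using assms e unfolding fcauchy_iff by blast
  have "sn (sc c (a m) - sc c (a n)) < e" if "m \<ge> N" "n \<ge> N" for m n
  proof -
    have "sn (sc c (a m) - sc c (a n)) \<le> (cmod c + 1) * sn (a m - a n)"
      using sn_ge0[OF diff_mem[OF mem mem]] by (simp add: sn_sc_diff mem mult_right_mono)
    also have "\<dots> < e" using N that by (simp add: less_divide_eq mult.commute add_nonneg_pos)
    finally show ?thesis .
  qed
  then show "\<exists>N. \<forall>m\<ge>N. \<forall>n\<ge>N. sn (sc c (a m) - sc c (a n)) < e" by blast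
qed

lemma fcauchy_const: "A \<in> S \<Longrightarrow> fcauchy fs S (\<lambda>_. A)"
  by (auto simp: fcauchy_def zero_right zero_mem)

lemma hnorm_tendsto:
  assumes "h \<in> completion fs S"
  shows "(\<lambda>n. sn (rep h n)) \<longlonglongrightarrow> hnorm fs h"
proof -
  have f: "fcauchy fs S (rep h)" using rep_mem assms by auto
  then have mem: "rep h n \<in> S" for n by (auto simp: fcauchy_def)
  have "Cauchy (\<lambda>n. sn (rep h n))"
  proof (rule CauchyI)
    fix e :: real assume "e > 0"
    then obtain N where "\<forall>m\<ge>N. \<forall>n\<ge>N. sn (rep h m - rep h n) < e" using f unfolding fcauchy_iff by blast
    then show "\<exists>N. \<forall>m\<ge>N. \<forall>n\<ge>N. norm (sn (rep h m) - sn (rep h n)) < e"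
      using sn_triangle_diff[OF mem mem] by (metis order_le_less_trans real_norm_def)
  qed
  then have "convergent (\<lambda>n. sn (rep h n))" by (simp add: Cauchy_convergent)
  then show ?thesis unfolding hnorm_def sn_def rep_def by (simp add: convergent_LIMSEQ_iff)
qed

text \<open>\<open>L\<close> is the limit of \<open>q\<close> along a representative. By
  \<open>bounded_functional_fequiv\<close> any representative gives the same limit, so the termwise
  sum or multiple may replace the one chosen for the new class.\<close>

lemma extension_exists:
  assumes q: "bounded_functional q C"
  shows "\<exists>L. (\<forall>A\<in>S. L (emb fs S A) = q A) \<and>
     (\<forall>h\<in>completion fs S. \<forall>k\<in>completion fs S. L (hadd fs S h k) = L h + L k) \<and>
     (\<forall>c. \<forall>h\<in>completion fs S. L (hscale sc fs S c h) = c * L h) \<and>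
     (\<exists>C. \<forall>h\<in>completion fs S. cmod (L h) \<le> C * hnorm fs h)"
proof -
  define L where "L h = lim (\<lambda>n. q (rep h n))" for h
  have Lc: "L (fequiv fs S `` {a}) = lim (\<lambda>n. q (a n))" if "fcauchy fs S a" for a
    unfolding L_def using bounded_functional_fequiv[OF q rep_class[OF that]] by simp
  have Lt: "(\<lambda>n. q (rep h n)) \<longlonglongrightarrow> L h" if "h \<in> completion fs S" for h
    unfolding L_def using bounded_functional_convergent[OF q rep_mem(1)[OF that]] by (simp add: convergent_LIMSEQ_iff)
  have mem: "rep h n \<in> S" if "h \<in> completion fs S" for h n using rep_mem(1)[OF that] by (simp add: fcauchy_def)
  have lin: "q (A + B) = q A + q B" "q (sc c A) = c * q A" "cmod (q A) \<le> C * sn A"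
    if "A \<in> S" "B \<in> S" for A B c
    using q that unfolding bounded_functional_def by auto
  show ?thesis
  proof (intro exI[of _ L] conjI ballI allI exI[of _ C])
    fix A assume "A \<in> S"
    then show "L (emb fs S A) = q A" unfolding emb_def by (simp add: Lc fcauchy_const)
  next
    fix h k assume h: "h \<in> completion fs S" and k: "k \<in> completion fs S"
    have "L (hadd fs S h k) = lim (\<lambda>n. q (rep h n + rep k n))"
      unfolding hadd_def rep_def[symmetric] by (intro Lc fcauchy_add rep_mem h k)
    also have "\<dots> = lim (\<lambda>n. q (rep h n) + q (rep k n))" using lin(1)[OF mem[OF h] mem[OF k]] by simp
    also have "\<dots> = L h + L k" by (intro limI tendsto_add Lt h k)
    finally show "L (hadd fs S h k) = L h + L k" .
  next
    fix c h assume h: "h \<in> completion fs S"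
    have "L (hscale sc fs S c h) = lim (\<lambda>n. q (sc c (rep h n)))"
      unfolding hscale_def rep_def[symmetric] by (intro Lc fcauchy_sc rep_mem h)
    also have "\<dots> = lim (\<lambda>n. c * q (rep h n))" using lin(2)[OF mem[OF h] mem[OF h]] by simp
    also have "\<dots> = c * L h" by (intro limI tendsto_mult tendsto_const Lt h)
    finally show "L (hscale sc fs S c h) = c * L h" .
  next
    fix h assume h: "h \<in> completion fs S"
    show "cmod (L h) \<le> C * hnorm fs h"
      by (rule LIMSEQ_le[OF tendsto_norm[OF Lt[OF h]] tendsto_mult[OF tendsto_const hnorm_tendsto[OF h]]])
         (use lin(3)[OF mem[OF h] mem[OF h]] in auto)
  qed
qed

text \<open>The functional \<open>fs A A - 2 Re (q A)\<close> is bounded below, and any minimising sequence is Cauchy and represents \<open>q\<close>.\<close>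
lemma Riesz:
  assumes q: "bounded_functional q C"
  shows "\<exists>h\<in>completion fs S. \<forall>B\<in>S. q B = hform fs h B"
proof -
  define \<epsilon> :: "nat \<Rightarrow> real" where "\<epsilon> n = 1 / real (Suc n)" for n
  define J where "J A = Re (fs A A) - 2 * Re (q A)" for A
  have lin: "q (A + B) = q A + q B" "q (sc c A) = c * q A" "cmod (q A) \<le> C * sn A"
    if "A \<in> S" "B \<in> S" for A B c
    using q that unfolding bounded_functional_def by auto
  \<comment> \<open>Completing the square: \<open>J A + C\<^sup>2\<close> is at least
    \<open>(sn A - C)\<^sup>2\<close>.\<close>
  have bdd: "- C\<^sup>2 \<le> J A" if "A \<in> S" for A
  proof -
    have "Re (q A) \<le> C * sn A" using lin(3)[OF that that] complex_Re_le_cmod[of "q A"] by linarith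
    then have "J A \<ge> (sn A)\<^sup>2 - 2 * (C * sn A)" using sn_sq[OF that] by (simp add: J_def)
    moreover have "(sn A)\<^sup>2 - 2 * (C * sn A) + C\<^sup>2 = (sn A - C)\<^sup>2" by (simp add: power2_eq_square algebra_simps)
    ultimately show ?thesis using zero_le_power2[of "sn A - C"] by linarith
  qed
  define I where "I = Inf (J ` S)"
  have bb: "bdd_below (J ` S)" using bdd by (auto simp: bdd_below_def)
  have I_le: "I \<le> J A" if "A \<in> S" for A unfolding I_def using bb that by (intro cINF_lower) auto
  have "\<exists>A\<in>S. J A < I + \<epsilon> n" for n
  proof -
    have "Inf (J ` S) < I + \<epsilon> n" by (simp add: I_def \<epsilon>_def)
    then show ?thesis using cInf_lessD[of "J ` S" "I + \<epsilon> n"] zero_mem by auto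
  qed
  then obtain a where a: "\<And>n. a n \<in> S" and aJ: "\<And>n. J (a n) < I + \<epsilon> n" by metis
  \<comment> \<open>The parallelogram identity at the midpoint. Since \<open>J\<close> there is
    still at least \<open>I\<close>, two almost-minimisers lie close together.\<close>
  have par: "J (sc (1/2) (A + B)) = J A / 2 + J B / 2 - Re (fs (A - B) (A - B)) / 4" if "A \<in> S" "B \<in> S" for A B
    using that herm[OF that] unfolding J_def
    by (simp add: sc_left sc_right add_mem sc_mem diff_mem add_left add_right diff_left diff_right lin algebra_simps)
       (simp add: field_simps)
  have quarter: "X < 2 * (u + v)" if "j = x / 2 + y / 2 - X / 4" "I \<le> j" "x < I + u" "y < I + v"
    for X u v j x y :: real using that by argo
  have d: "Re (fs (a m - a n) (a m - a n)) < 2 * (\<epsilon> m + \<epsilon> n)" for m n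
    by (rule quarter[OF par[OF a a] I_le[OF sc_mem[OF add_mem[OF a a]]] aJ aJ])
  have fc: "fcauchy fs S a"
    unfolding fcauchy_def
  proof (intro conjI allI a impI)
    fix e :: real assume e: "e > 0"
    then obtain N where N: "\<epsilon> N < e / 4" using nat_approx_posE[of "e/4"] by (auto simp: \<epsilon>_def)
    have "Re (fs (a m - a n) (a m - a n)) < e" if "m \<ge> N" "n \<ge> N" for m n
    proof -
      have "\<epsilon> m \<le> \<epsilon> N" "\<epsilon> n \<le> \<epsilon> N"
        using that by (auto intro!: divide_left_mono simp: \<epsilon>_def)
      then have "2 * (\<epsilon> m + \<epsilon> n) < e" using N by argo
      then show ?thesis using d[of m n] by (rule less_trans[rotated])
    qed
    then show "\<exists>N. \<forall>m\<ge>N. \<forall>n\<ge>N. Re (fs (a m - a n) (a m - a n)) < e" by blast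
  qed
  \<comment> \<open>The infimum need not be attained in \<open>S\<close>, so the Euler equation is
    replaced by an inequality: moving \<open>a n\<close> by \<open>t\<close> times
    \<open>sc c B\<close> cannot lower \<open>J\<close> by more than \<open>\<epsilon> n\<close>.
    For fixed \<open>t\<close> the error \<open>\<epsilon> n / t\<close> vanishes as
    \<open>n\<close> grows. A free complex \<open>c\<close> lets real parts determine the whole
    number.\<close>
  have var: "Re (q (sc c B) - fs (a n) (sc c B)) * 2 \<le> \<epsilon> n / t + t * ((cmod c)\<^sup>2 * Re (fs B B))"
    if B: "B \<in> S" and t: "t > 0" for B c t n
  proof -
    have "J (a n + sc (of_real t) (sc c B)) = J (a n) + 2 * t * Re (fs (a n) (sc c B) - q (sc c B)) + t\<^sup>2 * Re (fs (sc c B) (sc c B))"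
      unfolding J_def using B a t by (subst Re_fs_plus) (auto simp: sc_mem lin add_mem algebra_simps)
    moreover have "Re (fs (sc c B) (sc c B)) = (cmod c)\<^sup>2 * Re (fs B B)"
      using sn_sq[OF sc_mem[OF B, of c]] sn_sq[OF B] sn_sc[OF B, of c] by (simp add: power_mult_distrib)
    ultimately have "2 * t * Re (q (sc c B) - fs (a n) (sc c B)) \<le> \<epsilon> n + t\<^sup>2 * ((cmod c)\<^sup>2 * Re (fs B B))"
      using I_le[OF add_mem[OF a sc_mem[OF sc_mem[OF B]]], of n "of_real t" c] aJ[of n] by (simp add: algebra_simps)
    then have "(2 * t * Re (q (sc c B) - fs (a n) (sc c B))) / t \<le> (\<epsilon> n + t\<^sup>2 * ((cmod c)\<^sup>2 * Re (fs B B))) / t"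
      using t by (intro divide_right_mono) auto
    then show ?thesis using t by (simp add: add_divide_distrib power2_eq_square)
  qed
  define h where "h = fequiv fs S `` {a}"
  have hC: "h \<in> completion fs S" unfolding h_def by (rule class_mem_completion[OF fc])
  have le: "Re (c * (q B - hform fs h B)) \<le> 0" if B: "B \<in> S" for B c
  proof (rule ccontr)
    define v where "v = Re (c * (q B - hform fs h B))"
    assume "\<not> v \<le> 0"
    then have v: "v > 0" by simp
    \<comment> \<open>With \<open>t = v / K\<close> the quadratic error is at most \<open>v\<close>,
      against \<open>2 * v\<close> on the left in the limit. The summand 1 keeps \<open>K\<close>
      positive when \<open>B\<close> is a null vector.\<close>
    define K where "K = (cmod c)\<^sup>2 * Re (fs B B) + 1"
    have K: "K > 0" using pos[OF B] by (simp add: K_def add_nonneg_pos)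
    define t where "t = v / K"
    have t: "t > 0" using v K by (simp add: t_def)
    have tK: "t * ((cmod c)\<^sup>2 * Re (fs B B)) \<le> v"
    proof -
      have "t * ((cmod c)\<^sup>2 * Re (fs B B)) \<le> t * K" using t by (intro mult_left_mono) (auto simp: K_def)
      then show ?thesis using K by (simp add: t_def)
    qed
    have "Re (c * (q B - fs (a n) B)) * 2 \<le> \<epsilon> n / t + v" for n
      using var[OF B t, of c n] tK lin(2)[OF B B] by (simp add: sc_right a B algebra_simps)
    moreover have "(\<lambda>n. Re (c * (q B - fs (a n) B)) * 2) \<longlonglongrightarrow> v * 2"
      unfolding v_def h_def by (intro tendsto_intros hform_class fc B)
    moreover have "(\<lambda>n. \<epsilon> n / t + v) \<longlonglongrightarrow> 0 / t + v" unfolding \<epsilon>_def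
      using t by (intro tendsto_intros LIMSEQ_Suc[OF lim_1_over_n]) auto
    ultimately have "v * 2 \<le> 0 / t + v" by (meson LIMSEQ_le)
    then show False using v by simp
  qed
  have "q B = hform fs h B" if B: "B \<in> S" for B
  proof -
    have "Re (cnj (q B - hform fs h B) * (q B - hform fs h B)) \<le> 0" by (rule le[OF B])
    then have "(cmod (q B - hform fs h B))\<^sup>2 \<le> 0" unfolding cmod_power2 by (simp add: power2_eq_square algebra_simps)
    then show ?thesis by simp
  qed
  then show ?thesis using hC by blast
qed

end


section \<open>Translations on local observables\<close>

text \<open>Completeness and the bound go through one induction because the step needs both:
  completeness makes the old span closed, so a new vector has positive distance from it, and that
  distance bounds the coefficient of the new vector.\<close>

lemma linear_bounded_on_finite_span:
  fixes B :: "'v::real_normed_vector set" and T :: "'v \<Rightarrow> 'w::real_normed_vector"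
  assumes T: "linear T" and "finite B"
  shows "complete (span B) \<and> (\<exists>K\<ge>0. \<forall>x\<in>span B. norm (T x) \<le> K * norm x)"
  using \<open>finite B\<close>
proof induction
  case empty
  show ?case using linear_0[OF T] by (auto intro!: exI[of _ 0] simp: compact_imp_complete)
next
  case (insert v B)
  then obtain K where comp: "complete (span B)" and K: "K \<ge> 0" "\<And>x. x \<in> span B \<Longrightarrow> norm (T x) \<le> K * norm x" by auto
  show ?case
  proof (cases "v \<in> span B")
    case True
    then have "span (insert v B) = span B" by (rule span_redundant)
    then show ?thesis using comp K by auto
  next
    case False
    define \<delta> where "\<delta> = infdist v (span B)"
    have "closed (span B)" using comp by (rule complete_imp_closed)
    then have \<delta>: "\<delta> > 0"
      unfolding \<delta>_def using False in_closed_iff_infdist_zero[of "span B" v] span_zero[of B] infdist_nonneg[of v "span B"]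
      by fastforce
    \<comment> \<open>Dividing by \<open>c\<close> exhibits \<open>v - (1/c) *\<^sub>R y\<close> up
      to sign conventions as a point of \<open>span B\<close>, so \<open>(1/c) *\<^sub>R y\<close>
      has norm at least \<delta>.\<close>
    have coef: "\<bar>c\<bar> * \<delta> \<le> norm y" if "y - c *\<^sub>R v \<in> span B" for y c
    proof (cases "c = 0")
      case False
      have "- (1/c) *\<^sub>R (y - c *\<^sub>R v) \<in> span B" using that by (intro span_scale)
      then have "\<delta> \<le> dist v (- (1/c) *\<^sub>R (y - c *\<^sub>R v))" unfolding \<delta>_def by (rule infdist_le)
      also have "v - (- (1/c) *\<^sub>R (y - c *\<^sub>R v)) = (1/c) *\<^sub>R y" using False by (simp add: algebra_simps)
      then have "dist v (- (1/c) *\<^sub>R (y - c *\<^sub>R v)) = norm y / \<bar>c\<bar>"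
        unfolding dist_norm by simp
      finally show ?thesis using False by (simp add: pos_le_divide_eq mult.commute)
    qed simp
    have mem: "y \<in> span (insert v B) \<longleftrightarrow> (\<exists>c. y - c *\<^sub>R v \<in> span B)" for y
      by (rule span_breakdown_eq)
    define K' where "K' = K * (1 + norm v / \<delta>) + norm (T v) / \<delta>"
    have "norm (T y) \<le> K' * norm y" if y: "y \<in> span (insert v B)" for y
    proof -
      obtain c where c: "y - c *\<^sub>R v \<in> span B" using y mem by blast
      have cb: "\<bar>c\<bar> \<le> norm y / \<delta>" using coef[OF c] \<delta> by (simp add: pos_le_divide_eq)
      have s: "norm (y - c *\<^sub>R v) \<le> norm y + norm y / \<delta> * norm v"
      proof -
        have "norm (y - c *\<^sub>R v) \<le> norm y + \<bar>c\<bar> * norm v" using norm_triangle_ineq4[of y "c *\<^sub>R v"] by simp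
        also have "\<dots> \<le> norm y + norm y / \<delta> * norm v" using cb by (intro add_left_mono mult_right_mono) auto
        finally show ?thesis .
      qed
      have "T y = T (y - c *\<^sub>R v) + c *\<^sub>R T v"
        using linear_diff[OF T] linear_scale[OF T] by simp
      then have "norm (T y) \<le> norm (T (y - c *\<^sub>R v)) + \<bar>c\<bar> * norm (T v)"
        by (metis norm_scaleR norm_triangle_ineq)
      also have "\<dots> \<le> K * (norm y + norm y / \<delta> * norm v) + norm y / \<delta> * norm (T v)"
        using K(2)[OF c] mult_left_mono[OF s K(1)] mult_right_mono[OF cb, of "norm (T v)"] by auto
      also have "\<dots> = K' * norm y" by (simp add: K'_def algebra_simps)
      finally show ?thesis .
    qed
    moreover have "K' \<ge> 0" using K \<delta> by (simp add: K'_def)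
    moreover have "complete (span (insert v B))"
    proof (rule completeI)
      fix y assume y: "\<forall>n. y n \<in> span (insert v B)" and cau: "Cauchy y"
      have "\<exists>c. \<forall>n. y n - c n *\<^sub>R v \<in> span B" using y mem by (intro choice) auto
      then obtain c where c: "\<And>n. y n - c n *\<^sub>R v \<in> span B" by blast
      have "Cauchy c"
      proof (rule CauchyI)
        fix e :: real assume "e > 0"
        then have "e * \<delta> > 0" using \<delta> by simp
        then obtain M where M: "\<forall>m\<ge>M. \<forall>n\<ge>M. norm (y m - y n) < e * \<delta>" using CauchyD[OF cau] by blast
        have "norm (c m - c n) < e" if "m \<ge> M" "n \<ge> M" for m n
        proof -
          have "(y m - y n) - (c m - c n) *\<^sub>R v = (y m - c m *\<^sub>R v) - (y n - c n *\<^sub>R v)" by (simp add: algebra_simps)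
          then have "(y m - y n) - (c m - c n) *\<^sub>R v \<in> span B" using span_diff[OF c c, of m n] by (simp only:)
          then have "\<bar>c m - c n\<bar> * \<delta> < e * \<delta>" using coef M that by (meson order_le_less_trans)
          then show ?thesis using \<delta> by simp
        qed
        then show "\<exists>M. \<forall>m\<ge>M. \<forall>n\<ge>M. norm (c m - c n) < e" by blast
      qed
      then obtain c0 where c0: "c \<longlonglongrightarrow> c0" using Cauchy_convergent convergent_def by blast
      have cv: "Cauchy (\<lambda>n. c n *\<^sub>R v)"
        using bounded_linear.Cauchy[OF bounded_linear_scaleR_left \<open>Cauchy c\<close>] .
      have "Cauchy (\<lambda>n. y n - c n *\<^sub>R v)"
      proof (rule CauchyI)
        fix e :: real assume "e > 0"
        then have e: "e / 2 > 0" by simp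
        obtain M1 where M1: "\<forall>m\<ge>M1. \<forall>n\<ge>M1. norm (y m - y n) < e / 2" using CauchyD[OF cau e] by blast
        obtain M2 where M2: "\<forall>m\<ge>M2. \<forall>n\<ge>M2. norm (c m *\<^sub>R v - c n *\<^sub>R v) < e / 2" using CauchyD[OF cv e] by blast
        have "norm ((y m - c m *\<^sub>R v) - (y n - c n *\<^sub>R v)) < e" if "m \<ge> max M1 M2" "n \<ge> max M1 M2" for m n
        proof -
          have "norm (y m - y n) < e / 2" "norm (c m *\<^sub>R v - c n *\<^sub>R v) < e / 2" using M1 M2 that by auto
          moreover have eqn: "(y m - c m *\<^sub>R v) - (y n - c n *\<^sub>R v) = (y m - y n) - (c m *\<^sub>R v - c n *\<^sub>R v)" by simp
          ultimately show ?thesis using norm_triangle_ineq4[of "y m - y n" "c m *\<^sub>R v - c n *\<^sub>R v"]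
            unfolding eqn by argo
        qed
        then show "\<exists>M. \<forall>m\<ge>M. \<forall>n\<ge>M. norm ((y m - c m *\<^sub>R v) - (y n - c n *\<^sub>R v)) < e" by blast
      qed
      then obtain s where s: "s \<in> span B" "(\<lambda>n. y n - c n *\<^sub>R v) \<longlonglongrightarrow> s"
        using completeE[OF comp, of "\<lambda>n. y n - c n *\<^sub>R v"] c by blast
      have "(\<lambda>n. (y n - c n *\<^sub>R v) + c n *\<^sub>R v) \<longlonglongrightarrow> s + c0 *\<^sub>R v"
        by (intro tendsto_intros s c0)
      moreover have "s + c0 *\<^sub>R v \<in> span (insert v B)" using mem s by (metis add_diff_cancel_right')
      ultimately show "\<exists>l\<in>span (insert v B). y \<longlonglongrightarrow> l" by auto
    qed
    ultimately show ?thesis by blast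
  qed
qed

text \<open>If \<open>a > b\<close>, the powers of \<open>a / b\<close> outgrow \<open>K\<close>.
  The exponents are powers of two because iterating the C*-identity yields exactly these.\<close>

lemma le_of_powers_le:
  fixes a b K :: real
  assumes "a \<ge> 0" "b \<ge> 0" "\<And>n. a ^ (2 ^ n) \<le> K * b ^ (2 ^ n)"
  shows "a \<le> b"
proof (rule ccontr)
  assume ab: "\<not> a \<le> b"
  show False
  proof (cases "b = 0")
    case True
    then show False using assms(3)[of 0] ab by simp
  next
    case False
    then have b: "b > 0" using assms by simp
    define r where "r = a / b"
    have r: "r > 1" using ab b by (simp add: r_def)
    obtain n where n: "K < r ^ n" using real_arch_pow[OF r] by blast
    have "r ^ n \<le> r ^ (2 ^ n)" using r by (intro power_increasing) (auto simp: less_imp_le)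
    also have "\<dots> = a ^ (2^n) / b ^ (2^n)" by (simp add: r_def power_divide)
    also have "\<dots> \<le> K" using assms(3)[of n] b by (simp add: pos_divide_le_eq)
    finally show False using n by simp
  qed
qed

locale clustering_lattice =
  fixes sc :: "complex \<Rightarrow> 'a::{real_normed_algebra_1,banach} \<Rightarrow> 'a"
    and star :: "'a \<Rightarrow> 'a"
    and Oloc :: "(int^'d) set \<Rightarrow> 'a set"
    and iota :: "int^'d \<Rightarrow> 'a \<Rightarrow> 'a"
    and \<omega> :: "'a \<Rightarrow> complex"
  assumes setting: "lattice_setting sc star Oloc iota"
    and clustering: "clustering_state sc star Oloc iota \<omega>"
begin

section \<open>The C*-algebra, its local subalgebras and the translations\<close>

lemma cstar: "cstar_algebra sc star"
  using setting unfolding lattice_setting_def by (elim conjE)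

lemma sc_real: "sc (complex_of_real r) x = r *\<^sub>R x"
  and sc_sc: "sc a (sc b x) = sc (a * b) x"
  and sc_add_left: "sc (a + b) x = sc a x + sc b x"
  and sc_add_right: "sc a (x + y) = sc a x + sc a y"
  and sc_mult_left: "sc a x * y = sc a (x * y)"
  and sc_mult_right: "x * sc a y = sc a (x * y)"
  and star_star: "star (star x) = x"
  and star_add: "star (x + y) = star x + star y"
  and star_sc: "star (sc a x) = sc (cnj a) (star x)"
  and star_mult: "star (x * y) = star y * star x"
  and norm_star_mult: "norm (star x * x) = (norm x)\<^sup>2"
  using cstar unfolding cstar_algebra_def by metis+

lemma sc_0: "sc 0 x = 0" using sc_real[of 0 x] by simp
lemma sc_minus: "sc (-1) x = - x" using sc_real[of "-1" x] by simp
lemma sc_diff_right: "sc a (x - y) = sc a x - sc a y"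
proof -
  have "sc a (- y) = - sc a y" using sc_sc[of a "-1" y] sc_sc[of "-1" a y] by (simp add: sc_minus)
  then show ?thesis using sc_add_right[of a x "- y"] by simp
qed
lemma star_minus: "star (- x) = - star x" using star_sc[of "-1" x] by (simp add: sc_minus)
lemma star_diff: "star (x - y) = star x - star y" using star_add[of x "- y"] by (simp add: star_minus)
lemma star_one: "star 1 = 1" using star_mult[of 1 "star 1"] star_star by simp

lemma Oloc_findim: "finite X \<Longrightarrow> fin_dim_csubspace sc (Oloc X)"
  and Oloc_one: "finite X \<Longrightarrow> 1 \<in> Oloc X"
  and Oloc_mult: "finite X \<Longrightarrow> A \<in> Oloc X \<Longrightarrow> B \<in> Oloc X \<Longrightarrow> A * B \<in> Oloc X"
  and Oloc_star: "finite X \<Longrightarrow> A \<in> Oloc X \<Longrightarrow> star A \<in> Oloc X"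
  using setting unfolding lattice_setting_def by metis+

lemma Oloc_empty: "Oloc {} = range (\<lambda>c. sc c 1)"
  and Oloc_mono: "finite Y \<Longrightarrow> X \<subseteq> Y \<Longrightarrow> Oloc X \<subseteq> Oloc Y"
  and Oloc_Int: "finite X \<Longrightarrow> finite Y \<Longrightarrow> Oloc X \<inter> Oloc Y = Oloc (X \<inter> Y)"
  using setting unfolding lattice_setting_def by metis+

lemma iota_one: "iota x 1 = 1"
  and iota_add: "iota x (A + B) = iota x A + iota x B"
  and iota_mult: "iota x (A * B) = iota x A * iota x B"
  and iota_sc: "iota x (sc c A) = sc c (iota x A)"
  and iota_star: "iota x (star A) = star (iota x A)"
  and iota_iota: "iota x (iota y A) = iota (x + y) A"
  and iota_bij: "bij (iota x)"
  using setting unfolding lattice_setting_def by metis+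

lemma iota_Obs: "A \<in> Obs Oloc \<Longrightarrow> iota x A \<in> Obs Oloc"
  and supp_iota: "A \<in> Obs Oloc \<Longrightarrow> supp Oloc (iota x A) = (\<lambda>y. y + x) ` supp Oloc A"
  using setting unfolding lattice_setting_def by metis+

text \<open>The group law makes \<open>iota 0\<close> idempotent, and an injective idempotent map is
  the identity.\<close>

lemma iota_0: "iota 0 A = A"
proof -
  have "iota 0 (iota 0 A) = iota 0 A" by (simp add: iota_iota)
  then show ?thesis using iota_bij[of 0] by (metis bij_pointE)
qed

lemma Oloc_add: "finite X \<Longrightarrow> A \<in> Oloc X \<Longrightarrow> B \<in> Oloc X \<Longrightarrow> A + B \<in> Oloc X"
  and Oloc_sc: "finite X \<Longrightarrow> A \<in> Oloc X \<Longrightarrow> sc c A \<in> Oloc X"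
proof -
  assume X: "finite X" and A: "A \<in> Oloc X"
  obtain G where G: "finite G" "Oloc X = {\<Sum>b\<in>G. sc (c b) b | c. True}"
    using Oloc_findim[OF X] unfolding fin_dim_csubspace_def by blast
  obtain a where a: "A = (\<Sum>b\<in>G. sc (a b) b)" using A G by auto
  have sc_sum: "sc c (\<Sum>b\<in>H. h b) = (\<Sum>b\<in>H. sc c (h b))" if "finite H" for H and h :: "'a \<Rightarrow> 'a"
    using that by induction (use sc_add_right[of c 0 0] in \<open>auto simp: sc_add_right\<close>)
  show "sc c A \<in> Oloc X" unfolding G a
    by (rule CollectI, rule exI[of _ "\<lambda>b. c * a b"]) (simp add: sc_sum G sc_sc)
  assume B: "B \<in> Oloc X"
  obtain b where b: "B = (\<Sum>x\<in>G. sc (b x) x)" using B G by auto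
  show "A + B \<in> Oloc X" unfolding G a b
    by (rule CollectI, rule exI[of _ "\<lambda>x. a x + b x"]) (simp add: sc_add_left sum.distrib)
qed

lemma Obs_iff: "A \<in> Obs Oloc \<longleftrightarrow> (\<exists>X. finite X \<and> A \<in> Oloc X)"
  unfolding Obs_def by auto

lemma Obs_common:
  assumes "A \<in> Obs Oloc" "B \<in> Obs Oloc"
  obtains X where "finite X" "A \<in> Oloc X" "B \<in> Oloc X"
proof -
  obtain X Y where "finite X" "A \<in> Oloc X" "finite Y" "B \<in> Oloc Y" using assms by (auto simp: Obs_iff)
  then show ?thesis using that[of "X \<union> Y"] Oloc_mono[of "X \<union> Y" X] Oloc_mono[of "X \<union> Y" Y] by auto
qed

lemma Obs_add: "A \<in> Obs Oloc \<Longrightarrow> B \<in> Obs Oloc \<Longrightarrow> A + B \<in> Obs Oloc"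
  using Obs_common Oloc_add Obs_iff by metis
lemma Obs_sc: "A \<in> Obs Oloc \<Longrightarrow> sc c A \<in> Obs Oloc"
  using Oloc_sc Obs_iff by metis
lemma Obs_star: "A \<in> Obs Oloc \<Longrightarrow> star A \<in> Obs Oloc"
  using Oloc_star Obs_iff by metis
lemma Obs_0: "0 \<in> Obs Oloc"
  using Oloc_sc[of "{}" 1 0] Oloc_one[of "{}"] by (auto simp: Obs_iff sc_0 intro!: exI[of _ "{}"])

text \<open>Gives the description operator in \<open>supp\<close> a value. A localising set of least
  cardinality is contained in every other one, because by the intersection axiom their intersection
  localises as well.\<close>

lemma supp_props:
  assumes "A \<in> Obs Oloc"
  shows "finite (supp Oloc A)" "A \<in> Oloc (supp Oloc A)" "\<And>Y. finite Y \<Longrightarrow> A \<in> Oloc Y \<Longrightarrow> supp Oloc A \<subseteq> Y"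
proof -
  obtain X0 where X0: "finite X0 \<and> A \<in> Oloc X0" using assms by (auto simp: Obs_iff)
  obtain X where X: "finite X" "A \<in> Oloc X" and mini: "\<And>Y. finite Y \<and> A \<in> Oloc Y \<Longrightarrow> card X \<le> card Y"
    using ex_has_least_nat[of "\<lambda>X. finite X \<and> A \<in> Oloc X" X0 card] X0 by blast
  have sub: "X \<subseteq> Y" if Y: "finite Y" "A \<in> Oloc Y" for Y
  proof -
    have "A \<in> Oloc (X \<inter> Y)" using Oloc_Int[OF X(1) Y(1)] X Y by auto
    then have "card X \<le> card (X \<inter> Y)" using mini X(1) by simp
    then have "X \<inter> Y = X" using X(1) by (meson card_seteq inf_le1)
    then show ?thesis by auto
  qed
  have "supp Oloc A = X" unfolding supp_def
    by (rule the_equality) (use X sub in \<open>auto intro: subset_antisym\<close>)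
  then show "finite (supp Oloc A)" "A \<in> Oloc (supp Oloc A)" "\<And>Y. finite Y \<Longrightarrow> A \<in> Oloc Y \<Longrightarrow> supp Oloc A \<subseteq> Y"
    using X sub by auto
qed

text \<open>The axioms translate supports only; monotonicity carries this over to the local
  algebras.\<close>

lemma iota_Oloc:
  assumes "finite X" "A \<in> Oloc X"
  shows "iota x A \<in> Oloc ((\<lambda>y. y + x) ` X)"
proof -
  have A: "A \<in> Obs Oloc" using assms by (auto simp: Obs_iff)
  have "supp Oloc (iota x A) \<subseteq> (\<lambda>y. y + x) ` X"
    using supp_iota[OF A] supp_props(3)[OF A assms] by auto
  then show ?thesis using supp_props(2)[OF iota_Obs[OF A]] Oloc_mono assms(1) by blast
qed

lemma linear_iota: "linear (iota x)"
  by (rule linearI) (simp_all add: iota_add iota_sc flip: sc_real)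

text \<open>The boundedness lemma works over the reals, so the complex spanning set is doubled by
  its multiples with \<open>\<i>\<close>.\<close>

lemma Oloc_real_span:
  assumes "finite X"
  obtains G where "finite G" "Oloc X \<subseteq> span G"
proof -
  obtain G where G: "finite G" "Oloc X = {\<Sum>b\<in>G. sc (c b) b | c. True}"
    using Oloc_findim[OF assms] unfolding fin_dim_csubspace_def by blast
  have "sc c b \<in> span (G \<union> sc \<i> ` G)" if "b \<in> G" for c b
  proof -
    have "sc c b = sc (of_real (Re c) + of_real (Im c) * \<i>) b" by (metis complex_eq mult.commute)
    also have "\<dots> = Re c *\<^sub>R b + Im c *\<^sub>R sc \<i> b" by (simp add: sc_add_left sc_real flip: sc_sc)
    also have "\<dots> \<in> span (G \<union> sc \<i> ` G)" using that by (intro span_add span_scale span_base) auto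
    finally show ?thesis .
  qed
  then have "Oloc X \<subseteq> span (G \<union> sc \<i> ` G)" unfolding G by (auto intro!: span_sum)
  then show ?thesis using that[of "G \<union> sc \<i> ` G"] G by auto
qed

lemma Oloc_power: "finite X \<Longrightarrow> A \<in> Oloc X \<Longrightarrow> A ^ n \<in> Oloc X"
  by (induction n) (auto simp: Oloc_one Oloc_mult)

lemma star_power: "star b = b \<Longrightarrow> star (b ^ n) = b ^ n"
  by (induction n) (auto simp: star_one star_mult power_commutes)

lemma iota_power: "iota x (b ^ n) = iota x b ^ n"
  by (induction n) (auto simp: iota_one iota_mult)

lemma norm_selfadjoint_power: "star b = b \<Longrightarrow> norm (b ^ (2 ^ n)) = norm b ^ (2 ^ n)"
proof (induction n)
  case (Suc n)
  have "norm (b ^ (2 ^ Suc n)) = norm (star (b ^ (2^n)) * b ^ (2^n))"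
    using Suc by (simp add: star_power power_add mult_2)
  also have "\<dots> = (norm b ^ (2^n))\<^sup>2" using Suc by (simp add: norm_star_mult)
  also have "\<dots> = norm b ^ (2 ^ Suc n)" by (simp only: power_Suc2 power_mult)
  finally show ?case .
qed simp

text \<open>\<open>iota x\<close> is bounded on the finite-dimensional algebra containing \<open>A\<close>; applying this to high powers of
  \<open>A\<^sup>* A\<close> and using the C*-identity removes the constant.\<close>
lemma norm_iota_le:
  assumes "A \<in> Obs Oloc"
  shows "norm (iota x A) \<le> norm A"
proof -
  obtain X where X: "finite X" "A \<in> Oloc X" using assms by (auto simp: Obs_iff)
  define b where "b = star A * A"
  have b: "b \<in> Oloc X" "star b = b" using X by (auto simp: b_def Oloc_mult Oloc_star star_mult star_star)
  then have ib: "star (iota x b) = iota x b" by (simp flip: iota_star)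
  obtain G where G: "finite G" "Oloc X \<subseteq> span G" using Oloc_real_span[OF X(1)] .
  obtain K where K: "\<And>y. y \<in> span G \<Longrightarrow> norm (iota x y) \<le> K * norm y"
    using linear_bounded_on_finite_span[OF linear_iota G(1)] by blast
  have "norm (iota x b) ^ (2^n) \<le> K * norm b ^ (2^n)" for n
  proof -
    have "norm (iota x (b ^ (2^n))) \<le> K * norm (b ^ (2^n))" using K G(2) Oloc_power[OF X(1) b(1)] by blast
    then show ?thesis by (simp add: iota_power norm_selfadjoint_power b ib)
  qed
  then have "norm (iota x b) \<le> norm b" by (rule le_of_powers_le[OF norm_ge_zero norm_ge_zero])
  then have "(norm (iota x A))\<^sup>2 \<le> (norm A)\<^sup>2"
    by (simp add: b_def iota_mult iota_star norm_star_mult)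
  then show ?thesis by (rule power2_le_imp_le) simp
qed

section \<open>The state and its covariance\<close>

lemma \<omega>_add: "\<omega> (A + B) = \<omega> A + \<omega> B"
  and \<omega>_sc: "\<omega> (sc c A) = c * \<omega> A"
  and \<omega>_pos: "Im (\<omega> (star A * A)) = 0" "Re (\<omega> (star A * A)) \<ge> 0"
  and \<omega>_one: "\<omega> 1 = 1"
  and \<omega>_iota: "\<omega> (iota x A) = \<omega> A"
  using clustering unfolding clustering_state_def is_state_def by blast+

lemma \<omega>_minus: "\<omega> (- A) = - \<omega> A" using \<omega>_sc[of "-1" A] by (simp add: sc_minus)
lemma \<omega>_diff: "\<omega> (A - B) = \<omega> A - \<omega> B" using \<omega>_add[of A "- B"] by (simp add: \<omega>_minus)

text \<open>Hermiticity from positivity by polarisation: \<open>\<omega>\<close> is real at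
  \<open>star Y * Y\<close> for \<open>Y = A + sc c 1\<close>. Taking \<open>c = 1\<close> compares
  imaginary parts and \<open>c = \<i>\<close> real parts.\<close>

lemma \<omega>_star: "\<omega> (star A) = cnj (\<omega> A)"
proof -
  have *: "Im (c * \<omega> (star A) + cnj c * \<omega> A) = 0" for c
  proof -
    have "star (A + sc c 1) * (A + sc c 1) = star A * A + sc c (star A) + sc (cnj c) A + sc (cnj c * c) 1"
      by (simp add: star_add star_sc star_one distrib_left distrib_right sc_mult_left sc_mult_right sc_sc
          sc_add_right mult.commute)
    then have "\<omega> (star (A + sc c 1) * (A + sc c 1)) = \<omega> (star A * A) + (c * \<omega> (star A) + cnj c * \<omega> A) + cnj c * c"
      by (simp add: \<omega>_add \<omega>_sc \<omega>_one)
    moreover have "Im (cnj c * c) = 0" by simp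
    ultimately show ?thesis using \<omega>_pos(1)[of "A + sc c 1"] \<omega>_pos(1)[of A] by simp
  qed
  show ?thesis using *[of 1] *[of \<i>] by (simp add: complex_eq_iff)
qed

definition cs :: "'a \<Rightarrow> 'a \<Rightarrow> complex" where
  "cs A B = \<omega> (B * star A) - \<omega> B * \<omega> (star A)"

text \<open>The value is \<open>\<omega> (star X * X)\<close> for the centred adjoint
  \<open>X\<close> of \<open>A\<close>.\<close>

lemma cs_pos: "Re (cs A A) \<ge> 0"
proof -
  define X where "X = star A - sc (\<omega> (star A)) 1"
  have "star X = A - sc (\<omega> A) 1" by (simp add: X_def star_diff star_star star_sc star_one \<omega>_star)
  then have "star X * X = A * star A - sc (\<omega> (star A)) A - sc (\<omega> A) (star A) + sc (\<omega> A * \<omega> (star A)) 1"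
    by (simp add: X_def left_diff_distrib right_diff_distrib sc_mult_left sc_mult_right sc_sc
        sc_diff_right mult.commute)
  then have "\<omega> (star X * X) = cs A A" by (simp add: \<omega>_add \<omega>_diff \<omega>_sc \<omega>_one cs_def)
  then show ?thesis using \<omega>_pos(2)[of X] by simp
qed

sublocale cov: semi_inner sc UNIV cs
proof
  show "cs A (B + C) = cs A B + cs A C" for A B C by (simp add: cs_def distrib_right \<omega>_add algebra_simps)
  show "cs A (sc c B) = c * cs A B" for A B c by (simp add: cs_def sc_mult_left \<omega>_sc algebra_simps)
  show "cs B A = cnj (cs A B)" for A B
    by (simp add: cs_def \<omega>_star[of "B * star A", symmetric] \<omega>_star star_mult star_star mult.commute)
qed (auto simp: sc_minus cs_pos)

lemma cs_iota: "cs (iota x A) (iota x B) = cs A B"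
  by (simp add: cs_def \<omega>_iota flip: iota_star iota_mult)

lemma cs_iota_diff: "cs (iota x A) (iota y B) = cs A (iota (y - x) B)"
  using cs_iota[of x A "iota (y - x) B"] by (simp add: iota_iota)

lemma form_star_eq: "form_star star iota \<omega> A B = (\<Sum>\<^sub>\<infinity>x. cs A (iota x B))"
  unfolding form_star_def form_def cs_def by (simp add: iota_star star_star \<omega>_iota)

lemma cs_one_right: "cs A 1 = 0"
  by (simp add: cs_def \<omega>_one)

text \<open>The dictionary between pseudolocality and \<open>cs\<close>. Centering disappears
  because \<open>cs\<close> already subtracts the product of expectations; the adjoints account for
  the right version of the charge.\<close>

lemma \<omega>_centered: "\<omega> (star (centered sc \<omega> Q) * A) = cnj (cs (star Q) (star A))"
proof -
  have "\<omega> (star (centered sc \<omega> Q) * A) = cnj (\<omega> (star A * centered sc \<omega> Q))"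
    by (simp add: star_mult star_star flip: \<omega>_star)
  also have "\<omega> (star A * centered sc \<omega> Q) = cs (star Q) (star A)"
    by (simp add: centered_def right_diff_distrib \<omega>_diff sc_mult_right \<omega>_sc cs_def star_star)
  finally show ?thesis .
qed

lemma \<omega>_centered_sq: "Re (\<omega> (star (centered sc \<omega> Q) * centered sc \<omega> Q)) = Re (cs (star Q) (star Q))"
proof -
  have "cs (star Q) (star (centered sc \<omega> Q)) = cs (star Q) (star Q)"
    by (simp add: centered_def star_diff star_sc star_one cov.diff_right cov.sc_right cs_one_right)
  then show ?thesis by (simp add: \<omega>_centered)
qed

end


section \<open>Sums over the lattice\<close>

text \<open>Sup-norm balls are products of intervals: sums of product functions factorise over them
  and their cardinality is an exact power. Passing to and from the l1 balls \<open>ballZ\<close>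
  costs a factor \<open>CARD('d)\<close>.\<close>

definition cube :: "nat \<Rightarrow> (int^'d) set" where
  "cube m = {x. \<forall>i. \<bar>x $ i\<bar> \<le> int m}"

lemma bij_cube: "bij_betw vec_lambda (PiE UNIV (\<lambda>_. {- int m..int m})) (cube m :: (int^'d) set)"
  by (rule bij_betwI[where g = vec_nth]) (auto simp: cube_def vec_lambda_inverse vec_nth_inverse abs_le_iff PiE_def Pi_def, (smt (verit))+)

lemma finite_cube [simp]: "finite (cube m)"
  using bij_betw_finite[OF bij_cube] by (metis finite_PiE finite finite_atLeastAtMost_int)

lemma sum_cube_prod:
  fixes h :: "int \<Rightarrow> real"
  shows "(\<Sum>x\<in>(cube m :: (int^'d) set). \<Prod>i\<in>UNIV. h (x $ i)) = (\<Sum>k\<in>{- int m..int m}. h k) ^ CARD('d)"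
proof -
  have "(\<Sum>x\<in>(cube m :: (int^'d) set). \<Prod>i\<in>UNIV. h (x $ i))
      = (\<Sum>g\<in>PiE UNIV (\<lambda>_. {- int m..int m}). \<Prod>i\<in>(UNIV::'d set). h (g i))"
    using sum.reindex_bij_betw[OF bij_cube[of m], of "\<lambda>x::int^'d. \<Prod>i\<in>UNIV. h (x $ i)"] by (simp add: vec_lambda_inverse)
  also have "\<dots> = (\<Prod>i\<in>(UNIV::'d set). \<Sum>k\<in>{- int m..int m}. h k)"
    by (rule prod_sum_PiE[symmetric]) auto
  finally show ?thesis by simp
qed

lemma card_cube: "real (card (cube m :: (int^'d) set)) = (2 * real m + 1) ^ CARD('d)"
  using sum_cube_prod[of "\<lambda>_. 1" m, where 'd='d] by (simp add: nat_add_distrib add.commute)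

lemma cube_mono: "m \<le> n \<Longrightarrow> cube m \<subseteq> cube n"
  unfolding cube_def by (auto intro: order_trans)

lemma zero_in_cube: "0 \<in> cube m"
  by (simp add: cube_def)

lemma finite_subset_cube:
  assumes "finite (F :: (int^'d) set)"
  obtains m where "F \<subseteq> cube m"
proof -
  define m where "m = nat (\<Sum>x\<in>F. \<Sum>i\<in>UNIV. \<bar>x $ i\<bar>)"
  have "\<bar>x $ i\<bar> \<le> int m" if "x \<in> F" for x i
  proof -
    have "\<bar>x $ i\<bar> \<le> (\<Sum>i\<in>UNIV. \<bar>x $ i\<bar>)" by (rule member_le_sum) auto
    also have "\<dots> \<le> (\<Sum>x\<in>F. \<Sum>i\<in>UNIV. \<bar>x $ i\<bar>)"
      using that assms by (intro member_le_sum[of x F "\<lambda>x. \<Sum>i\<in>UNIV. \<bar>x $ i\<bar>"]) (auto intro: sum_nonneg)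
    also have "\<dots> \<le> int m" unfolding m_def by (rule nat_le_iff[THEN iffD1]) simp
    finally show ?thesis .
  qed
  then show ?thesis using that[of m] by (auto simp: cube_def)
qed

section \<open>Cubes against l1 balls, and summability of power decay\<close>

lemma abs_le_l1: "\<bar>x $ i\<bar> \<le> l1dist x 0"
  unfolding l1dist_def using member_le_sum[of i UNIV "\<lambda>i. \<bar>x $ i - 0 $ i\<bar>"] by simp

lemma l1_nonneg: "l1dist x y \<ge> 0"
  unfolding l1dist_def by (simp add: sum_nonneg)

lemma l1_cube: "(x::int^'d) \<in> cube m \<Longrightarrow> l1dist x 0 \<le> int (CARD('d) * m)"
  unfolding l1dist_def cube_def using sum_bounded_above[of "UNIV::'d set" "\<lambda>i. \<bar>x $ i - 0 $ i\<bar>" "int m"] by simp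

lemma finite_ballZ [simp]: "finite (ballZ r :: (int^'d) set)"
proof (rule finite_subset)
  show "ballZ r \<subseteq> (cube (nat \<lfloor>r\<rfloor>) :: (int^'d) set)"
  proof
    fix x :: "int^'d" assume "x \<in> ballZ r"
    then have "l1dist x 0 \<le> \<lfloor>r\<rfloor>" by (simp add: ballZ_def le_floor_iff)
    also have "\<lfloor>r\<rfloor> \<le> int (nat \<lfloor>r\<rfloor>)" by (rule nat_le_iff[THEN iffD1]) simp
    finally have "\<bar>x $ i\<bar> \<le> int (nat \<lfloor>r\<rfloor>)" for i using abs_le_l1[of x i] by (rule order_trans[rotated])
    then show "x \<in> cube (nat \<lfloor>r\<rfloor>)" by (simp add: cube_def)
  qed
qed simp

lemma sum_int_powr_bounded:
  assumes s: "s > 1"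
  obtains M where "\<And>m. (\<Sum>k\<in>{- int m..int m}. (1 + real_of_int \<bar>k\<bar>) powr (- s)) \<le> M" "M \<ge> 0"
proof -
  define h where "h n = (1 + real n) powr (- s)" for n
  have sm: "summable h"
  proof -
    have "summable (\<lambda>n. real n powr (- s))" using s by (simp add: summable_real_powr_iff)
    then have "summable (\<lambda>n. real (Suc n) powr (- s))" by (subst summable_Suc_iff)
    then show ?thesis by (simp add: h_def[abs_def] add.commute)
  qed
  have h0: "h n \<ge> 0" for n by (simp add: h_def)
  have "(\<Sum>k\<in>{- int m..int m}. (1 + real_of_int \<bar>k\<bar>) powr (- s)) \<le> 2 * suminf h" for m
  proof -
    \<comment> \<open>Both half-lines contain 0; the double count only enlarges the upper
      bound.\<close>
    have "{- int m..int m} \<subseteq> int ` {..m} \<union> (\<lambda>k. - int k) ` {..m}"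
    proof
      fix k assume "k \<in> {- int m..int m}"
      then show "k \<in> int ` {..m} \<union> (\<lambda>k. - int k) ` {..m}"
        by (cases "k \<ge> 0") (auto intro!: image_eqI[of _ _ "nat \<bar>k\<bar>"])
    qed
    then have "(\<Sum>k\<in>{- int m..int m}. (1 + real_of_int \<bar>k\<bar>) powr (- s)) \<le> (\<Sum>k\<in>int ` {..m} \<union> (\<lambda>k. - int k) ` {..m}. (1 + real_of_int \<bar>k\<bar>) powr (- s))"
      by (intro sum_mono2) auto
    also have "\<dots> \<le> (\<Sum>k\<in>int ` {..m}. (1 + real_of_int \<bar>k\<bar>) powr (- s)) + (\<Sum>k\<in>(\<lambda>k. - int k) ` {..m}. (1 + real_of_int \<bar>k\<bar>) powr (- s))"
      by (subst sum_Un) (auto intro!: sum_nonneg)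
    also have "\<dots> = 2 * (\<Sum>k\<le>m. h k)"
      by (simp add: sum.reindex inj_on_def h_def)
    also have "\<dots> \<le> 2 * suminf h" using sum_le_suminf[OF sm, of "{..m}"] h0 by simp
    finally show ?thesis .
  qed
  moreover have "2 * suminf h \<ge> 0" using suminf_nonneg[OF sm] h0 by simp
  ultimately show ?thesis using that by blast
qed

text \<open>Each \<open>1 + \<bar>x $ i\<bar>\<close> is at most one plus the l1 norm, so their
  product is at most its power \<open>CARD('d)\<close>. The decay is thus dominated by a product of
  one-dimensional decays with exponent \<open>s = p / CARD('d) > 1\<close>.\<close>

lemma l1_powr_summable:
  assumes p: "p > real CARD('d)"
  shows "(\<lambda>x::int^'d. (1 + real_of_int (l1dist x 0)) powr (- p)) summable_on UNIV"
proof (rule nonneg_bdd_above_summable_on)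
  define s where "s = p / real CARD('d)"
  have D: "real CARD('d) > 0" by simp
  have s: "s > 1" using p D unfolding s_def by (subst pos_less_divide_eq) auto
  obtain M where M: "\<And>m. (\<Sum>k\<in>{- int m..int m}. (1 + real_of_int \<bar>k\<bar>) powr (- s)) \<le> M" "M \<ge> 0"
    using sum_int_powr_bounded[OF s] by blast
  have le: "(1 + real_of_int (l1dist x 0)) powr (- p) \<le> (\<Prod>i\<in>UNIV. (1 + real_of_int \<bar>x $ i\<bar>) powr (- s))" for x :: "int^'d"
  proof -
    have "(\<Prod>i\<in>(UNIV::'d set). (1 + real_of_int \<bar>x $ i\<bar>)) \<le> (\<Prod>i\<in>(UNIV::'d set). (1 + real_of_int (l1dist x 0)))"
      by (intro prod_mono) (auto simp: abs_le_l1 simp flip: of_int_abs)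
    then have pl: "(\<Prod>i\<in>(UNIV::'d set). (1 + real_of_int \<bar>x $ i\<bar>)) \<le> (1 + real_of_int (l1dist x 0)) ^ CARD('d)" by simp
    have "(1 + real_of_int (l1dist x 0)) powr (- p) = ((1 + real_of_int (l1dist x 0)) powr real CARD('d)) powr (- s)"
      using D by (simp add: powr_powr s_def)
    also have "(1 + real_of_int (l1dist x 0)) powr real CARD('d) = (1 + real_of_int (l1dist x 0)) ^ CARD('d)"
      using l1_nonneg[of x 0] by (intro powr_realpow) auto
    also have "((1 + real_of_int (l1dist x 0)) ^ CARD('d)) powr (- s) \<le> (\<Prod>i\<in>(UNIV::'d set). (1 + real_of_int \<bar>x $ i\<bar>)) powr (- s)"
      using pl s by (intro powr_mono2') (auto intro!: prod_pos)
    also have "\<dots> = (\<Prod>i\<in>UNIV. (1 + real_of_int \<bar>x $ i\<bar>) powr (- s))"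
      by (rule prod_powr_distrib)
    finally show ?thesis .
  qed
  show "bdd_above (sum (\<lambda>x::int^'d. (1 + real_of_int (l1dist x 0)) powr (- p)) ` {F. F \<subseteq> UNIV \<and> finite F})"
  proof (rule bdd_aboveI2)
    fix F :: "(int^'d) set" assume "F \<in> {F. F \<subseteq> UNIV \<and> finite F}"
    then obtain m where m: "F \<subseteq> cube m" using finite_subset_cube by auto
    have "(\<Sum>x\<in>F. (1 + real_of_int (l1dist x 0)) powr (- p)) \<le> (\<Sum>x\<in>(cube m :: (int^'d) set). (1 + real_of_int (l1dist x 0)) powr (- p))"
      using m by (intro sum_mono2) auto
    also have "\<dots> \<le> (\<Sum>x\<in>(cube m :: (int^'d) set). \<Prod>i\<in>UNIV. (1 + real_of_int \<bar>x $ i\<bar>) powr (- s))"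
      by (intro sum_mono le)
    also have "\<dots> = (\<Sum>k\<in>{- int m..int m}. (1 + real_of_int \<bar>k\<bar>) powr (- s)) ^ CARD('d)"
      by (rule sum_cube_prod)
    also have "\<dots> \<le> M ^ CARD('d)" by (intro power_mono M sum_nonneg) auto
    finally show "(\<Sum>x\<in>F. (1 + real_of_int (l1dist x 0)) powr (- p)) \<le> M ^ CARD('d)" .
  qed
qed simp

lemma tail_tendsto_0:
  fixes f :: "int^'d \<Rightarrow> real"
  assumes f: "f summable_on UNIV"
  shows "(\<lambda>N. infsum f (- cube N)) \<longlonglongrightarrow> 0"
proof (rule LIMSEQ_I)
  fix e :: real assume e: "e > 0"
  have "(f has_sum infsum f UNIV) UNIV" using f by simp
  then have "\<forall>\<^sub>F F in finite_subsets_at_top UNIV. dist (sum f F) (infsum f UNIV) < e"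
    unfolding has_sum_def using e by (rule tendstoD)
  then obtain F where F: "finite F" "\<And>G. finite G \<Longrightarrow> F \<subseteq> G \<Longrightarrow> dist (sum f G) (infsum f UNIV) < e"
    unfolding eventually_finite_subsets_at_top by auto
  obtain m where m: "F \<subseteq> cube m" using finite_subset_cube[OF F(1)] .
  have "norm (infsum f (- cube N) - 0) < e" if "N \<ge> m" for N
  proof -
    have "infsum f (- cube N) = infsum f UNIV - sum f (cube N)"
      using infsum_Diff[OF f, of "cube N"] by (simp add: Compl_eq_Diff_UNIV)
    then show ?thesis using F(2)[of "cube N"] m cube_mono[OF that] by (auto simp: dist_real_def abs_minus_commute)
  qed
  then show "\<exists>no. \<forall>n\<ge>no. norm (infsum f (- cube n) - 0) < e" by blast
qed

text \<open>The error is bounded by the tail outside \<open>F\<close> for every finite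
  \<open>T\<close> above it, so one tail serves many sums; \<open>F = {}\<close> gives the crude
  bound by the whole absolute sum.\<close>

lemma infsum_minus_sum_le:
  fixes g :: "'i \<Rightarrow> complex"
  assumes g: "(\<lambda>x. norm (g x)) summable_on UNIV" and T: "finite T" "F \<subseteq> T"
  shows "norm (infsum g UNIV - sum g T) \<le> infsum (\<lambda>x. norm (g x)) (- F)"
proof -
  have gs: "g summable_on UNIV" using g by (rule abs_summable_summable)
  have "infsum g UNIV - sum g T = infsum g (- T)"
    using infsum_Diff[OF gs, of T] T by (simp add: Compl_eq_Diff_UNIV)
  also have "norm \<dots> \<le> infsum (\<lambda>x. norm (g x)) (- T)"
    using summable_on_subset_banach[OF g] by (intro norm_infsum_bound) auto
  also have "\<dots> \<le> infsum (\<lambda>x. norm (g x)) (- F)"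
    using summable_on_subset_banach[OF g] T by (intro infsum_mono2) auto
  finally show ?thesis .
qed

text \<open>A boundary layer of fixed width \<open>N\<close> has vanishing relative volume.\<close>

lemma cube_ratio_tendsto_1:
  "(\<lambda>m. real (card (cube (m - N) :: (int^'d) set)) / real (card (cube m :: (int^'d) set))) \<longlonglongrightarrow> 1"
proof -
  have "(\<lambda>m. 1 / real m) \<longlonglongrightarrow> 0" by (rule lim_1_over_n)
  then have "(\<lambda>m. 1 / real (2 * m + 1)) \<longlonglongrightarrow> 0"
    by (rule LIMSEQ_subseq_LIMSEQ[unfolded o_def]) (auto intro: strict_monoI)
  then have "(\<lambda>m. (1 - 2 * real N * (1 / real (2 * m + 1))) ^ CARD('d)) \<longlonglongrightarrow> (1 - 2 * real N * 0) ^ CARD('d)"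
    by (intro tendsto_intros)
  then have lim: "(\<lambda>m. (1 - 2 * real N * (1 / real (2 * m + 1))) ^ CARD('d)) \<longlonglongrightarrow> 1" by simp
  have "\<forall>\<^sub>F m in sequentially. (1 - 2 * real N * (1 / real (2 * m + 1))) ^ CARD('d)
      = real (card (cube (m - N) :: (int^'d) set)) / real (card (cube m :: (int^'d) set))"
  proof (rule eventually_sequentiallyI[of N])
    fix m assume "N \<le> m"
    then have "1 - 2 * real N * (1 / real (2 * m + 1)) = (2 * real (m - N) + 1) / (2 * real m + 1)"
      by (simp add: field_simps of_nat_diff)
    then show "(1 - 2 * real N * (1 / real (2 * m + 1))) ^ CARD('d)
      = real (card (cube (m - N) :: (int^'d) set)) / real (card (cube m :: (int^'d) set))"
      by (simp only: card_cube power_divide)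
  qed
  then show ?thesis using lim by (rule Lim_transform_eventually[rotated])
qed

text \<open>For \<open>x\<close> at depth \<open>N\<close> inside the cube, the differences
  \<open>y - x\<close> cover \<open>cube N\<close>, so the inner sum misses at most a tail. In the
  boundary layer each error is at most the absolute sum \<open>G\<close>, and the layer carries a
  vanishing share of the points.\<close>

lemma cube_average_tendsto:
  fixes g :: "int^'d \<Rightarrow> complex"
  assumes g: "(\<lambda>x. norm (g x)) summable_on UNIV"
  shows "(\<lambda>m. (\<Sum>x\<in>cube m. \<Sum>y\<in>cube m. g (y - x)) / of_nat (card (cube m :: (int^'d) set))) \<longlonglongrightarrow> infsum g UNIV"
proof (rule LIMSEQ_I)
  fix e :: real assume e: "e > 0"
  define G where "G = infsum (\<lambda>x. norm (g x)) UNIV"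
  define S where "S = infsum g UNIV"
  have e2: "e / 2 > 0" using e by simp
  obtain N where "norm (infsum (\<lambda>x. norm (g x)) (- cube N) - 0) < e / 2"
    using LIMSEQ_D[OF tail_tendsto_0[OF g] e2] by blast
  then have N: "infsum (\<lambda>x. norm (g x)) (- cube N) < e / 2" by simp
  define \<rho> where "\<rho> m = real (card (cube (m - N) :: (int^'d) set)) / real (card (cube m :: (int^'d) set))" for m
  have "(\<lambda>m. (1 - \<rho> m) * G) \<longlonglongrightarrow> (1 - 1) * G" unfolding \<rho>_def by (intro tendsto_intros cube_ratio_tendsto_1)
  then have "(\<lambda>m. (1 - \<rho> m) * G) \<longlonglongrightarrow> 0" by simp
  from LIMSEQ_D[OF this e2] obtain M where M: "\<And>m. m \<ge> M \<Longrightarrow> norm ((1 - \<rho> m) * G) < e / 2" by auto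
  have "norm ((\<Sum>x\<in>cube m. \<Sum>y\<in>cube m. g (y - x)) / of_nat (card (cube m :: (int^'d) set)) - S) < e"
    if m: "m \<ge> max M N" for m
  proof -
    define c where "c = real (card (cube m :: (int^'d) set))"
    have c: "c > 0" unfolding c_def card_cube by (intro zero_less_power) simp
    have inner: "(\<Sum>y\<in>cube m. g (y - x)) = sum g ((\<lambda>y. y - x) ` cube m)" for x
      by (subst sum.reindex) (auto simp: inj_on_def)
    have b1: "norm (S - (\<Sum>y\<in>cube m. g (y - x))) \<le> G" for x
      unfolding inner S_def G_def using infsum_minus_sum_le[OF g, of "(\<lambda>y. y - x) ` cube m" "{}"] by simp
    have b2: "norm (S - (\<Sum>y\<in>cube m. g (y - x))) \<le> e / 2" if x: "x \<in> cube (m - N)" for x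
    proof -
      have "cube N \<subseteq> (\<lambda>y. y - x) ` cube m"
      proof
        fix z :: "int^'d" assume z: "z \<in> cube N"
        have "\<bar>(z + x) $ i\<bar> \<le> int m" for i
        proof -
          have "\<bar>z $ i\<bar> \<le> int N" "\<bar>x $ i\<bar> \<le> int (m - N)" using z x by (auto simp: cube_def)
          then show ?thesis using m by auto
        qed
        then have "z + x \<in> cube m" by (simp add: cube_def)
        then show "z \<in> (\<lambda>y. y - x) ` cube m" by (rule rev_image_eqI) simp
      qed
      then show ?thesis
        unfolding inner S_def using infsum_minus_sum_le[OF g, of "(\<lambda>y. y - x) ` cube m" "cube N"] N by simp
    qed
    have sub: "cube (m - N) \<subseteq> (cube m :: (int^'d) set)" by (rule cube_mono) simp
    have "norm (of_real c * S - (\<Sum>x\<in>cube m. \<Sum>y\<in>cube m. g (y - x))) = norm (\<Sum>x\<in>(cube m::(int^'d) set). S - (\<Sum>y\<in>cube m. g (y - x)))"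
      by (simp add: sum_subtractf c_def)
    also have "\<dots> \<le> (\<Sum>x\<in>(cube m::(int^'d) set). norm (S - (\<Sum>y\<in>cube m. g (y - x))))" by (rule norm_sum)
    also have "\<dots> = (\<Sum>x\<in>cube m - cube (m - N). norm (S - (\<Sum>y\<in>cube m. g (y - x)))) + (\<Sum>x\<in>cube (m - N). norm (S - (\<Sum>y\<in>cube m. g (y - x))))"
      by (rule sum.subset_diff[OF sub]) simp
    also have "\<dots> \<le> (\<Sum>x\<in>(cube m - cube (m - N)::(int^'d) set). G) + (\<Sum>x\<in>(cube (m - N)::(int^'d) set). e / 2)"
      using b1 b2 by (intro add_mono sum_mono) auto
    also have "\<dots> = (c - \<rho> m * c) * G + \<rho> m * c * (e / 2)"
      using zero_in_cube[of m, where 'a='d] c card_mono[OF _ sub] by (auto simp add: card_Diff_subset sub of_nat_diff c_def \<rho>_def)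
    also have "\<dots> \<le> (c - \<rho> m * c) * G + c * (e / 2)"
    proof -
      have "\<rho> m * c \<le> c" using c card_mono[OF _ sub] by (simp add: c_def \<rho>_def)
      then have "\<rho> m * c * (e / 2) \<le> c * (e / 2)" using e by (intro mult_right_mono) auto
      then show ?thesis by simp
    qed
    also have "\<dots> = c * ((1 - \<rho> m) * G + e / 2)" by (simp add: algebra_simps)
    also have "\<dots> < c * e" using M[of m] m c by (intro mult_strict_left_mono) auto
    finally have main: "norm (of_real c * S - (\<Sum>x\<in>cube m. \<Sum>y\<in>cube m. g (y - x))) < c * e" .
    have "(\<Sum>x\<in>cube m. \<Sum>y\<in>cube m. g (y - x)) / of_nat (card (cube m :: (int^'d) set)) - S
        = - (of_real c * S - (\<Sum>x\<in>cube m. \<Sum>y\<in>cube m. g (y - x))) / of_real c"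
    proof -
      have "of_nat (card (cube m :: (int^'d) set)) = complex_of_real c" by (simp add: c_def)
      moreover have "complex_of_real c \<noteq> 0" using c by simp
      ultimately show ?thesis by (simp add: divide_simps)
    qed
    then have "norm ((\<Sum>x\<in>cube m. \<Sum>y\<in>cube m. g (y - x)) / of_nat (card (cube m :: (int^'d) set)) - S)
        = norm (of_real c * S - (\<Sum>x\<in>cube m. \<Sum>y\<in>cube m. g (y - x))) / c"
      using c by (simp add: norm_divide norm_minus_commute)
    then show ?thesis using main c by (simp add: pos_divide_less_eq mult.commute)
  qed
  then show "\<exists>no. \<forall>m\<ge>no. norm ((\<Sum>x\<in>cube m. \<Sum>y\<in>cube m. g (y - x)) / of_nat (card (cube m :: (int^'d) set)) - infsum g UNIV) < e"
    unfolding S_def by blast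
qed


section \<open>Clustering and the form\<close>

lemma not_cube_l1: "z \<notin> cube N \<Longrightarrow> l1dist z 0 > int N"
  unfolding cube_def using abs_le_l1[of z] by (auto simp: not_le intro: less_le_trans)

lemma l1_triangle: "l1dist z 0 \<le> l1dist (b + z) a + l1dist b 0 + l1dist a 0"
  unfolding l1dist_def sum.distrib[symmetric] by (rule sum_mono) auto

context clustering_lattice
begin

abbreviation "fs \<equiv> form_star star iota \<omega>"

text \<open>\<open>C\<close> and \<open>N\<close> depend on \<open>A\<close> and \<open>X\<close>
  but not on \<open>B\<close>: translates of elements of \<open>Oloc X\<close> have supports of at
  most \<open>card X\<close> sites, so one \<open>\<nu> l\<close> suffices. The exclusion of a cube
  keeps the supports at positive distance, where the power law for \<open>f\<close> is
  available.\<close>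

lemma clustering_decay:
  obtains p :: real where "p > real CARD('d)"
    and "\<And>A X. A \<in> Obs Oloc \<Longrightarrow> finite X \<Longrightarrow> \<exists>C\<ge>0. \<exists>N. \<forall>B\<in>Oloc X. \<forall>z. z \<notin> cube N \<longrightarrow>
           cmod (cs A (iota z B)) \<le> C * norm B * (1 + real_of_int (l1dist z 0)) powr (- p)"
proof -
  obtain \<nu> :: "nat \<Rightarrow> real" and f :: "int \<Rightarrow> real" and p :: real where
    \<nu>: "\<And>l. \<nu> l > 0" and f: "\<And>d. f d > 0" and p: "p > real CARD('d)" and fd: "\<And>d. d > 0 \<Longrightarrow> f d \<le> real_of_int d powr (- p)"
    and cl: "\<And>l A B. A \<in> Obs Oloc \<Longrightarrow> B \<in> Obs Oloc \<Longrightarrow> card (supp Oloc A) < l \<Longrightarrow> card (supp Oloc B) < l \<Longrightarrow>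
           supp Oloc A \<noteq> {} \<Longrightarrow> supp Oloc B \<noteq> {} \<Longrightarrow>
           cmod (\<omega> (A * B) - \<omega> A * \<omega> B) \<le> \<nu> l * norm A * norm B * f (set_dist (supp Oloc A) (supp Oloc B))"
    using clustering unfolding clustering_state_def by blast
  have p0: "p > 0" using p by (meson of_nat_0_le_iff order_le_less_trans)
  have scalar: "\<exists>c. A = sc c 1" if "A \<in> Obs Oloc" "supp Oloc A = {}" for A
    using supp_props(2)[OF that(1)] that(2) Oloc_empty by auto
  have "\<exists>C\<ge>0. \<exists>N. \<forall>B\<in>Oloc X. \<forall>z. z \<notin> cube N \<longrightarrow>
           cmod (cs A (iota z B)) \<le> C * norm B * (1 + real_of_int (l1dist z 0)) powr (- p)"
    if A: "A \<in> Obs Oloc" and X: "finite X" for A X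
  proof -
    define Y where "Y = supp Oloc (star A)"
    have sA: "star A \<in> Obs Oloc" using A by (rule Obs_star)
    have Y: "finite Y" unfolding Y_def by (rule supp_props(1)[OF sA])
    define l where "l = card X + card Y + 1"
    define r where "r = nat ((\<Sum>b\<in>X. l1dist b 0) + (\<Sum>a\<in>Y. l1dist a 0))"
    define C where "C = \<nu> l * norm (star A) * 2 powr p"
    have bound: "cmod (cs A (iota z B)) \<le> C * norm B * (1 + real_of_int (l1dist z 0)) powr (- p)"
      \<comment> \<open>Outside this cube the l1 norm of \<open>z\<close> exceeds
        \<open>2 * r + 1\<close>, so subtracting the extents of both supports, at most
        \<open>r\<close>, leaves at least half of one plus that norm. This half is the origin of
        \<open>2 powr p\<close> in \<open>C\<close>.\<close>
      if B: "B \<in> Oloc X" and z: "z \<notin> cube (2 * r + 1)" for B z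
    proof -
      have BO: "B \<in> Obs Oloc" using B X by (auto simp: Obs_iff)
      have iB: "iota z B \<in> Obs Oloc" using BO by (rule iota_Obs)
      define W where "W = supp Oloc (iota z B)"
      have W: "W \<subseteq> (\<lambda>y. y + z) ` X" unfolding W_def supp_iota[OF BO] using supp_props(3)[OF BO X B] by auto
      show ?thesis
      \<comment> \<open>The clustering hypothesis speaks of nonempty supports; otherwise one factor
        is scalar and the covariance vanishes.\<close>
      proof (cases "W = {} \<or> Y = {}")
        case True
        have "cs A (iota z B) = 0"
        proof (cases "W = {}")
          case True
          then obtain c where "iota z B = sc c 1" using scalar[OF iB] by (auto simp: W_def)
          then show ?thesis by (simp add: cov.sc_right cs_one_right)
        next
          case False
          then obtain c where "star A = sc c 1" using True scalar[OF sA] by (auto simp: Y_def)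
          then show ?thesis by (simp add: cs_def sc_mult_right \<omega>_sc \<omega>_one)
        qed
        then show ?thesis using \<nu>[of l] by (simp add: C_def)
      next
        case False
        have fW: "finite W" using W X by (meson finite_imageI finite_subset)
        define d where "d = set_dist W Y"
        have d_ge: "l1dist z 0 - int r \<le> d"
        proof -
          let ?S = "{l1dist x y | x y. x \<in> W \<and> y \<in> Y}"
          have "?S = (\<lambda>(x, y). l1dist x y) ` (W \<times> Y)" by auto
          then have "finite ?S" "?S \<noteq> {}" using fW Y False by auto
          then have "d \<in> ?S" unfolding d_def set_dist_def by (rule Min_in)
          then obtain x y where xy: "x \<in> W" "y \<in> Y" "d = l1dist x y" by auto
          then obtain b where b: "b \<in> X" "x = b + z" using W by auto
          have "l1dist b 0 \<le> (\<Sum>b\<in>X. l1dist b 0)" using b X by (intro member_le_sum) (auto simp: l1_nonneg)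
          moreover have "l1dist y 0 \<le> (\<Sum>a\<in>Y. l1dist a 0)" using xy Y by (intro member_le_sum) (auto simp: l1_nonneg)
          moreover have "int r = (\<Sum>b\<in>X. l1dist b 0) + (\<Sum>a\<in>Y. l1dist a 0)"
            unfolding r_def by (intro int_nat_eq[THEN trans] if_P add_nonneg_nonneg sum_nonneg l1_nonneg)
          ultimately show ?thesis using l1_triangle[of z b y] xy b by simp
        qed
        have zr: "l1dist z 0 > int (2 * r + 1)" using z by (rule not_cube_l1)
        have d2: "(1 + real_of_int (l1dist z 0)) / 2 \<le> real_of_int d"
        proof -
          have "1 + l1dist z 0 \<le> 2 * d" using d_ge zr by simp
          then have "real_of_int (1 + l1dist z 0) \<le> real_of_int (2 * d)" by (simp only: of_int_le_iff)
          then show ?thesis by simp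
        qed
        have d0: "d > 0" using d_ge zr by simp
        have z0: "1 + real_of_int (l1dist z 0) > 0" using l1_nonneg[of z 0] by simp
        have "f d \<le> real_of_int d powr (- p)" using d0 by (rule fd)
        also have "\<dots> \<le> ((1 + real_of_int (l1dist z 0)) / 2) powr (- p)"
          using d2 z0 p0 by (intro powr_mono2') auto
        also have "\<dots> = 2 powr p * (1 + real_of_int (l1dist z 0)) powr (- p)"
          using z0 by (simp add: powr_divide powr_minus field_simps)
        finally have fb: "f d \<le> 2 powr p * (1 + real_of_int (l1dist z 0)) powr (- p)" .
        have "card W \<le> card X" using card_mono[OF finite_imageI[OF X] W] card_image_le[OF X, of "\<lambda>y. y + z"] by linarith
        then have "cmod (cs A (iota z B)) \<le> \<nu> l * norm (iota z B) * norm (star A) * f d"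
          unfolding cs_def d_def W_def Y_def using cl[OF iB sA, of l] False by (simp add: l_def W_def Y_def)
        also have "\<dots> \<le> \<nu> l * norm B * norm (star A) * (2 powr p * (1 + real_of_int (l1dist z 0)) powr (- p))"
          using \<nu>[of l] f[of d] fb norm_iota_le[OF BO, of z]
          by (intro mult_mono) (auto intro!: mult_nonneg_nonneg)
        also have "\<dots> = C * norm B * (1 + real_of_int (l1dist z 0)) powr (- p)" by (simp add: C_def)
        finally show ?thesis .
      qed
    qed
    have "C \<ge> 0" using \<nu>[of l] by (simp add: C_def)
    then show ?thesis using bound by blast
  qed
  then show ?thesis using that[OF p] by blast
qed

lemma cs_abs_summable:
  assumes A: "A \<in> Obs Oloc" and B: "B \<in> Obs Oloc"
  shows "(\<lambda>x. norm (cs A (iota x B))) summable_on UNIV"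
proof -
  obtain X where X: "finite X" "B \<in> Oloc X" using B by (auto simp: Obs_iff)
  obtain p where p: "p > real CARD('d)" and dec: "\<exists>C\<ge>0. \<exists>N. \<forall>B\<in>Oloc X. \<forall>z. z \<notin> cube N \<longrightarrow>
           cmod (cs A (iota z B)) \<le> C * norm B * (1 + real_of_int (l1dist z 0)) powr (- p)"
    using clustering_decay A X(1) by metis
  obtain C N where CN: "\<And>z. z \<notin> cube N \<Longrightarrow> cmod (cs A (iota z B)) \<le> C * norm B * (1 + real_of_int (l1dist z 0)) powr (- p)"
    using dec X(2) by blast
  have "(\<lambda>z::int^'d. C * norm B * (1 + real_of_int (l1dist z 0)) powr (- p)) summable_on (- cube N)"
    by (rule summable_on_cmult_right[OF summable_on_subset_banach[OF l1_powr_summable[OF p]]]) simp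
  then have "(\<lambda>x. norm (cs A (iota x B))) summable_on (- cube N)"
    by (rule summable_on_comparison_test) (auto simp: CN)
  moreover have "(\<lambda>x. norm (cs A (iota x B))) summable_on cube N" by simp
  ultimately have "(\<lambda>x. norm (cs A (iota x B))) summable_on (cube N \<union> - cube N)"
    by (intro summable_on_Un_disjoint) auto
  then show ?thesis by simp
qed

lemma cs_summable: "A \<in> Obs Oloc \<Longrightarrow> B \<in> Obs Oloc \<Longrightarrow> (\<lambda>x. cs A (iota x B)) summable_on UNIV"
  using abs_summable_summable[OF cs_abs_summable] .

lemma cs_cube_sum:
  "cs (\<Sum>x\<in>cube m. iota x A) (\<Sum>y\<in>cube m. iota y B) = (\<Sum>x\<in>cube m. \<Sum>y\<in>cube m. cs A (iota (y - x) B))"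
  by (subst sum.swap) (simp add: cov.sum_left cov.sum_right cs_iota_diff)

lemma cube_average_form:
  assumes "A \<in> Obs Oloc" "B \<in> Obs Oloc"
  shows "(\<lambda>m. cs (\<Sum>x\<in>cube m. iota x A) (\<Sum>y\<in>cube m. iota y B) / of_nat (card (cube m :: (int^'d) set))) \<longlonglongrightarrow> fs A B"
  unfolding cs_cube_sum form_star_eq by (rule cube_average_tendsto[OF cs_abs_summable[OF assms]])

sublocale form: semi_inner sc "Obs Oloc" fs
proof
  fix A B C c
  show "0 \<in> Obs Oloc" by (rule Obs_0)
  show "sc (-1) A = - A" by (rule sc_minus)
  assume A: "A \<in> Obs Oloc"
  show "sc c A \<in> Obs Oloc" using A by (rule Obs_sc)
  show "Re (fs A A) \<ge> 0"
  proof (rule LIMSEQ_le_const[OF tendsto_Re[OF cube_average_form[OF A A]]])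
    show "\<exists>N. \<forall>m\<ge>N. 0 \<le> Re (cs (\<Sum>x\<in>cube m. iota x A) (\<Sum>y\<in>cube m. iota y A) / of_nat (card (cube m :: (int^'d) set)))"
      using cs_pos by (auto simp: Re_divide_of_nat)
  qed
  assume B: "B \<in> Obs Oloc"
  show "A + B \<in> Obs Oloc" using A B by (rule Obs_add)
  show "fs A (sc c B) = c * fs A B"
    unfolding form_star_eq by (simp add: iota_sc cov.sc_right infsum_cmult_right cs_summable[OF A B])
  show "fs B A = cnj (fs A B)"
  proof -
    have "fs B A = (\<Sum>\<^sub>\<infinity>x. cnj (cs A (iota (- x) B)))"
      unfolding form_star_eq
    proof (rule infsum_cong)
      fix x
      have "cs B (iota x A) = cnj (cs (iota x A) B)" by (simp add: cov.herm[of "iota x A" B])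
      then show "cs B (iota x A) = cnj (cs A (iota (- x) B))" using cs_iota_diff[of x A 0 B] by (simp add: iota_0)
    qed
    \<comment> \<open>Exchanging the arguments reverses the relative translation, undone by the
      reflection of the lattice.\<close>
    also have "\<dots> = (\<Sum>\<^sub>\<infinity>x. cnj (cs A (iota x B)))"
      by (rule infsum_reindex_bij_betw) (rule bij_uminus)
    also have "\<dots> = cnj (fs A B)" unfolding form_star_eq by (rule infsum_cnj)
    finally show ?thesis .
  qed
  assume C: "C \<in> Obs Oloc"
  show "fs A (B + C) = fs A B + fs A C"
    unfolding form_star_eq by (simp add: iota_add cov.add_right infsum_add cs_summable[OF A B] cs_summable[OF A C])
qed

end


section \<open>Charges and densities\<close>

lemma zero_in_ballZ: "r \<ge> 0 \<Longrightarrow> 0 \<in> ballZ r"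
  by (simp add: ballZ_def l1dist_def)

text \<open>\<open>J n\<close> is the largest index for which \<open>n\<close> has passed all
  thresholds up to it. However fast the thresholds grow, every finite batch of them is eventually
  passed, so \<open>J\<close> tends to infinity.\<close>

lemma slow_diagonal:
  fixes P :: "nat \<Rightarrow> nat \<Rightarrow> bool"
  assumes "\<And>j. \<forall>\<^sub>F n in sequentially. P j n"
  obtains J where "filterlim J at_top sequentially" "\<forall>\<^sub>F n in sequentially. P (J n) n"
proof -
  have "\<exists>N. \<forall>n\<ge>N. P j n" for j using assms[of j] by (simp add: eventually_sequentially)
  then have "\<exists>N. \<forall>j. \<forall>n\<ge>N j. P j n" by (rule choice[OF allI])
  then obtain N where N: "\<And>j n. n \<ge> N j \<Longrightarrow> P j n" by blast
  \<comment> \<open>The cap \<open>j \<le> n\<close> makes \<open>G n\<close> finite; it is nonempty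
    from \<open>N 0\<close> on, where the claim about \<open>P\<close> begins.\<close>
  define G where "G n = {j. j \<le> n \<and> (\<forall>i\<le>j. N i \<le> n)}" for n
  define J where "J n = Max (G n)" for n
  have fin: "finite (G n)" for n by (rule finite_subset[of _ "{..n}"]) (auto simp: G_def)
  have ge: "J n \<ge> j" if "n \<ge> j + (\<Sum>i\<le>j. N i)" for j n
  proof -
    have "N i \<le> n" if "i \<le> j" for i
      using member_le_sum[of i "{..j}" N] that \<open>n \<ge> j + (\<Sum>i\<le>j. N i)\<close> by simp
    then have "j \<in> G n" using that by (simp add: G_def)
    then show ?thesis unfolding J_def using fin by (rule Max_ge[rotated])
  qed
  have "filterlim J at_top sequentially"
    unfolding filterlim_at_top using ge eventually_sequentially by blast
  moreover have "\<forall>\<^sub>F n in sequentially. P (J n) n"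
  proof (rule eventually_sequentiallyI[of "N 0"])
    fix n assume "N 0 \<le> n"
    then have "0 \<in> G n" by (simp add: G_def)
    then have "J n \<in> G n" unfolding J_def using fin by (intro Max_in) auto
    then show "P (J n) n" using N by (simp add: G_def)
  qed
  ultimately show ?thesis using that by blast
qed

context clustering_lattice
begin

section \<open>From charges to bounded functionals\<close>

lemma charge_star_tendsto:
  assumes Q: "pseudolocal sc star Oloc iota \<omega> Q" and B: "B \<in> Obs Oloc"
  shows "(\<lambda>n. cs (star (Q n)) B) \<longlonglongrightarrow> charge_star sc star Oloc \<omega> Q B"
proof -
  have "convergent (\<lambda>n. \<omega> (star (centered sc \<omega> (Q n)) * star B))"
    using Q Obs_star[OF B] unfolding pseudolocal_def by blast
  then have "(\<lambda>n. cnj (\<omega> (star (centered sc \<omega> (Q n)) * star B))) \<longlonglongrightarrow> charge_star sc star Oloc \<omega> Q B"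
    unfolding charge_star_def using B by (auto simp: convergent_LIMSEQ_iff intro!: tendsto_cnj)
  then show ?thesis by (simp add: \<omega>_centered star_star)
qed

lemma charge_star_bounded:
  assumes Q: "pseudolocal sc star Oloc iota \<omega> Q"
  shows "\<exists>K. form.bounded_functional (charge_star sc star Oloc \<omega> Q) K"
proof -
  define q where "q = charge_star sc star Oloc \<omega> Q"
  define R where "R n = star (Q n)" for n
  have lim: "(\<lambda>n. cs (R n) B) \<longlonglongrightarrow> q B" if "B \<in> Obs Oloc" for B
    unfolding R_def q_def by (rule charge_star_tendsto[OF Q that])
  obtain \<gamma> where \<gamma>: "\<gamma> > 0" "\<And>n. n > 0 \<Longrightarrow> Re (cs (R n) (R n)) \<le> \<gamma> * real n ^ CARD('d)"
    using Q unfolding pseudolocal_def \<omega>_centered_sq R_def by blast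
  define M where "M k A n = Max ((\<lambda>(x, y). cmod (\<omega> (star (centered sc \<omega> (Q n)) * iota x A) - \<omega> (star (centered sc \<omega> (Q n)) * iota y A)))
                      ` (ballZ (k * real n) \<times> ballZ (k * real n)))" for k A n
  obtain k where k: "0 < k" "k < 1" and M0: "\<And>A. A \<in> Obs Oloc \<Longrightarrow> M k A \<longlonglongrightarrow> 0"
    using Q unfolding pseudolocal_def M_def by blast
  define D where "D = real CARD('d)"
  have D: "D > 0" by (simp add: D_def)
  \<comment> \<open>The cube of half-side \<open>m n\<close> has l1 radius at most
    \<open>CARD('d) * m n \<le> k * n\<close>, so it lies in the ball on which the charge is almost
    invariant.\<close>
  define m where "m n = nat \<lfloor>k * real n / D\<rfloor>" for n
  \<comment> \<open>Rounding down still leaves \<open>n \<le> (D / k) * (2 * m n + 1)\<close>; the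
    power \<open>CARD('d)\<close> of this turns \<open>\<gamma> * n ^ CARD('d)\<close> into at most
    \<open>K\<close> times the number of sites in the cube.\<close>
  define K where "K = \<gamma> * (D / k) ^ CARD('d)"
  have m_le: "D * real (m n) \<le> k * real n" for n
  proof -
    have "k * real n / D \<ge> 0" using k D by simp
    then have "real (m n) \<le> k * real n / D" unfolding m_def by linarith
    then show ?thesis using D by (simp add: pos_le_divide_eq mult.commute)
  qed
  have m_ge: "real n \<le> (D / k) * (2 * real (m n) + 1)" for n
  proof -
    have "k * real n / D \<le> real (m n) + 1" unfolding m_def by linarith
    also have "\<dots> \<le> 2 * real (m n) + 1" by simp
    finally show ?thesis using D k by (simp add: field_simps)
  qed
  have m_lim: "filterlim m at_top sequentially"
    unfolding filterlim_at_top
  proof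
    fix Z
    obtain n0 :: nat where n0: "real n0 \<ge> D / k * (2 * real Z + 1)" using real_arch_simple by blast
    show "\<forall>\<^sub>F n in sequentially. Z \<le> m n"
    proof (rule eventually_sequentiallyI[of n0])
      fix n assume "n0 \<le> n"
      then have "D / k * (2 * real Z + 1) \<le> (D / k) * (2 * real (m n) + 1)" using n0 m_ge[of n] by (meson of_nat_le_iff order_trans)
      moreover have "D / k > 0" using D k by simp
      ultimately have "2 * real Z + 1 \<le> 2 * real (m n) + 1" by (simp only: mult_le_cancel_left_pos)
      then show "Z \<le> m n" by simp
    qed
  qed
  have bound: "(cmod (q B))\<^sup>2 \<le> K * Re (fs B B)" if B: "B \<in> Obs Oloc" for B
  proof -
    define c where "c n = real (card (cube (m n) :: (int^'d) set))" for n
    have c: "c n > 0" for n unfolding c_def card_cube by (intro zero_less_power) simp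
    define avg where "avg n = (\<Sum>x\<in>cube (m n). cs (R n) (iota x B)) / of_real (c n)" for n
    define F where "F n = cs (\<Sum>x\<in>cube n. iota x B) (\<Sum>y\<in>cube n. iota y B) / of_nat (card (cube n :: (int^'d) set))" for n
    have F: "(\<lambda>n. F (m n)) \<longlonglongrightarrow> fs B B"
      using filterlim_compose[OF cube_average_form[OF B B] m_lim] by (simp add: F_def)
    have diff: "cmod (cs (R n) B - avg n) \<le> M k (star B) n" for n
    proof -
      have each: "cmod (cs (R n) B - cs (R n) (iota x B)) \<le> M k (star B) n" if x: "x \<in> cube (m n)" for x
      proof -
        have "real_of_int (l1dist x 0) \<le> real_of_int (int (CARD('d) * m n))" using l1_cube[OF x] by (simp only: of_int_le_iff)
        also have "\<dots> \<le> k * real n" using m_le[of n] by (simp add: D_def)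
        finally have xb: "x \<in> ballZ (k * real n)" by (simp add: ballZ_def)
        have 0: "0 \<in> ballZ (k * real n)" using k by (intro zero_in_ballZ) simp
        \<comment> \<open>Condition (III) is used for \<open>star B\<close> at the sites 0 and
          \<open>x\<close>, since the right charge is a conjugate of the left one at the
          adjoint.\<close>
        have "cmod (\<omega> (star (centered sc \<omega> (Q n)) * iota 0 (star B)) - \<omega> (star (centered sc \<omega> (Q n)) * iota x (star B))) \<le> M k (star B) n"
          unfolding M_def by (rule Max_ge) (use xb 0 in \<open>auto intro!: image_eqI[of _ _ "(0, x)"]\<close>)
        moreover have "\<omega> (star (centered sc \<omega> (Q n)) * iota 0 (star B)) - \<omega> (star (centered sc \<omega> (Q n)) * iota x (star B))
            = cnj (cs (R n) B - cs (R n) (iota x B))"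
          by (simp add: \<omega>_centered iota_star star_star iota_0 R_def)
        ultimately show ?thesis by (simp only: complex_mod_cnj)
      qed
      have "of_real (c n) * (cs (R n) B - avg n) = (\<Sum>x\<in>(cube (m n) :: (int^'d) set). cs (R n) B - cs (R n) (iota x B))"
        using c[of n] by (simp add: sum_subtractf avg_def right_diff_distrib) (simp add: c_def)
      then have "c n * cmod (cs (R n) B - avg n) = cmod (\<Sum>x\<in>(cube (m n) :: (int^'d) set). cs (R n) B - cs (R n) (iota x B))"
        using c[of n] by (metis abs_of_pos norm_mult norm_of_real)
      also have "\<dots> \<le> (\<Sum>x\<in>(cube (m n) :: (int^'d) set). M k (star B) n)" by (intro sum_norm_le each)
      also have "\<dots> = c n * M k (star B) n" by (simp add: c_def)
      finally show ?thesis using c[of n] by simp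
    qed
    have "(\<lambda>n. cs (R n) B - avg n) \<longlonglongrightarrow> 0"
      by (rule Lim_null_comparison[OF always_eventually M0[OF Obs_star[OF B]]]) (simp add: diff)
    from tendsto_diff[OF lim[OF B] this] have avg_lim: "avg \<longlonglongrightarrow> q B" by simp
    have "(cmod (avg n))\<^sup>2 \<le> K * Re (F (m n))" if n: "n > 0" for n
    proof -
      define V where "V = (\<Sum>x\<in>cube (m n). iota x B)"
      have V0: "Re (cs V V) \<ge> 0" by (rule cs_pos)
      have "avg n = cs (R n) V / of_real (c n)" by (simp add: avg_def V_def cov.sum_right)
      then have "(cmod (avg n))\<^sup>2 = (cmod (cs (R n) V))\<^sup>2 / (c n)\<^sup>2" using c[of n] by (simp add: norm_divide power_divide)
      also have "\<dots> \<le> (Re (cs (R n) (R n)) * Re (cs V V)) / (c n)\<^sup>2"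
        by (intro divide_right_mono cov.Cauchy_Schwarz_sq) auto
      also have "\<dots> \<le> (K * c n * Re (cs V V)) / (c n)\<^sup>2"
      proof (intro divide_right_mono mult_right_mono V0)
        have "Re (cs (R n) (R n)) \<le> \<gamma> * real n ^ CARD('d)" by (rule \<gamma>(2)[OF n])
        also have "\<dots> \<le> \<gamma> * ((D / k) * (2 * real (m n) + 1)) ^ CARD('d)"
          using \<gamma>(1) m_ge[of n] by (intro mult_left_mono power_mono) auto
        also have "\<dots> = K * c n" by (simp only: K_def c_def card_cube power_mult_distrib mult.assoc)
        finally show "Re (cs (R n) (R n)) \<le> K * c n" .
      qed simp
      also have "\<dots> = K * (Re (cs V V) / c n)" using c[of n] by (simp add: power2_eq_square)
      also have "Re (cs V V) / c n = Re (F (m n))" by (simp add: F_def V_def c_def Re_divide_of_nat)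
      finally show ?thesis .
    qed
    then have ev: "\<forall>\<^sub>F n in sequentially. (cmod (avg n))\<^sup>2 \<le> K * Re (F (m n))"
      by (intro eventually_sequentiallyI[of 1]) auto
    have "(\<lambda>n. (cmod (avg n))\<^sup>2) \<longlonglongrightarrow> (cmod (q B))\<^sup>2" by (intro tendsto_intros avg_lim)
    moreover have "(\<lambda>n. K * Re (F (m n))) \<longlonglongrightarrow> K * Re (fs B B)" by (intro tendsto_intros F)
    ultimately show ?thesis using ev by (intro tendsto_le[OF trivial_limit_sequentially])
  qed
  have "form.bounded_functional q (sqrt K)"
    unfolding form.bounded_functional_def
  proof (intro conjI ballI allI)
    fix A B c assume A: "A \<in> Obs Oloc"
    have "(\<lambda>n. c * cs (R n) A) \<longlonglongrightarrow> c * q A" by (intro tendsto_intros lim A)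
    then show "q (sc c A) = c * q A"
      by (intro LIMSEQ_unique[OF lim[OF Obs_sc[OF A]]]) (simp add: cov.sc_right)
    show "cmod (q A) \<le> sqrt K * form.sn A"
      unfolding form.sn_def using bound[OF A] by (simp add: real_le_rsqrt flip: real_sqrt_mult)
    assume B: "B \<in> Obs Oloc"
    have "(\<lambda>n. cs (R n) A + cs (R n) B) \<longlonglongrightarrow> q A + q B" by (intro tendsto_intros lim A B)
    then show "q (A + B) = q A + q B"
      by (intro LIMSEQ_unique[OF lim[OF Obs_add[OF A B]]]) (simp add: cov.add_right)
  qed
  then show ?thesis unfolding q_def by blast
qed

text \<open>Uniformity over a whole local algebra lets a single slowly growing index serve all observables at once.\<close>
lemma form_truncation:
  assumes A: "A \<in> Obs Oloc" and X: "finite X" and e: "e > 0"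
  shows "\<exists>N. \<forall>B\<in>Oloc X. \<forall>T. finite T \<longrightarrow> cube N \<subseteq> T \<longrightarrow> cmod (fs A B - (\<Sum>z\<in>T. cs A (iota z B))) \<le> e * norm B"
proof -
  obtain p :: real where p: "p > real CARD('d)"
    and dec: "\<exists>C\<ge>0. \<exists>N. \<forall>B\<in>Oloc X. \<forall>z. z \<notin> cube N \<longrightarrow>
           cmod (cs A (iota z B)) \<le> C * norm B * (1 + real_of_int (l1dist z 0)) powr (- p)"
    using clustering_decay A X by metis
  define P :: "int^'d \<Rightarrow> real" where "P z = (1 + real_of_int (l1dist z 0)) powr (- p)" for z
  obtain C N0 where C: "C \<ge> 0" and CN: "\<And>B z. B \<in> Oloc X \<Longrightarrow> z \<notin> cube N0 \<Longrightarrow> cmod (cs A (iota z B)) \<le> C * norm B * P z"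
    using dec unfolding P_def by blast
  have Ps: "P summable_on UNIV" unfolding P_def[abs_def] by (rule l1_powr_summable[OF p])
  have "(\<lambda>N. C * infsum P (- cube N)) \<longlonglongrightarrow> C * 0"
    by (intro tendsto_intros tail_tendsto_0[OF Ps])
  then have "(\<lambda>N. C * infsum P (- cube N)) \<longlonglongrightarrow> 0" by simp
  from LIMSEQ_D[OF this e] obtain N1 where N1: "\<And>N. N \<ge> N1 \<Longrightarrow> C * infsum P (- cube N) < e" by (auto simp: abs_less_iff)
  define N where "N = max N0 N1"
  have "cmod (fs A B - (\<Sum>z\<in>T. cs A (iota z B))) \<le> e * norm B" if B: "B \<in> Oloc X" and T: "finite T" "cube N \<subseteq> T" for B T
  proof -
    have BO: "B \<in> Obs Oloc" using B X by (auto simp: Obs_iff)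
    have "cmod (fs A B - (\<Sum>z\<in>T. cs A (iota z B))) \<le> infsum (\<lambda>z. cmod (cs A (iota z B))) (- cube N)"
      unfolding form_star_eq by (rule infsum_minus_sum_le[OF cs_abs_summable[OF A BO] T])
    also have "\<dots> \<le> infsum (\<lambda>z. C * norm B * P z) (- cube N)"
    proof (rule infsum_mono)
      show "(\<lambda>z. cmod (cs A (iota z B))) summable_on - cube N"
        by (rule summable_on_subset_banach[OF cs_abs_summable[OF A BO]]) simp
      show "(\<lambda>z. C * norm B * P z) summable_on - cube N"
        by (rule summable_on_cmult_right[OF summable_on_subset_banach[OF Ps]]) simp
      fix z :: "int^'d" assume "z \<in> - cube N"
      then have "z \<notin> cube N0" using cube_mono[of N0 N] by (auto simp: N_def)
      then show "cmod (cs A (iota z B)) \<le> C * norm B * P z" by (rule CN[OF B])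
    qed
    also have "\<dots> = C * norm B * infsum P (- cube N)" by (rule infsum_cmult_right')
    also have "\<dots> \<le> e * norm B" using mult_right_mono[OF less_imp_le[OF N1[of N]], of "norm B"] by (simp add: N_def mult_ac)
    finally show ?thesis .
  qed
  then show ?thesis by blast
qed

section \<open>From densities to charges\<close>

lemma Oloc_0: "finite X \<Longrightarrow> 0 \<in> Oloc X"
  using Oloc_sc[of X 1 0] Oloc_one[of X] by (simp add: sc_0)

lemma Oloc_sum: "finite X \<Longrightarrow> (\<And>i. i \<in> I \<Longrightarrow> g i \<in> Oloc X) \<Longrightarrow> (\<Sum>i\<in>I. g i) \<in> Oloc X"
  by (induction I rule: infinite_finite_induct) (auto simp: Oloc_0 Oloc_add)

text \<open>The radius is a real variable because it will be \<open>n / 2\<close> for the summands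
  of a block and an index of the sequence for test observables.\<close>

lemma Obs_in_ball:
  assumes "A \<in> Obs Oloc"
  obtains r :: nat where "\<And>s. s \<ge> real r \<Longrightarrow> A \<in> Oloc (ballZ s)"
proof -
  obtain X where X: "finite X" "A \<in> Oloc X" using assms by (auto simp: Obs_iff)
  define r where "r = nat (\<Sum>x\<in>X. l1dist x 0)"
  have "A \<in> Oloc (ballZ s)" if s: "s \<ge> real r" for s
  proof -
    have "X \<subseteq> ballZ s"
    proof
      fix x assume "x \<in> X"
      then have "l1dist x 0 \<le> (\<Sum>x\<in>X. l1dist x 0)" using X by (intro member_le_sum) (auto simp: l1_nonneg)
      also have "\<dots> \<le> int r" unfolding r_def by (rule nat_le_iff[THEN iffD1]) simp
      finally have "real_of_int (l1dist x 0) \<le> real_of_int (int r)" by (simp only: of_int_le_iff)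
      then show "x \<in> ballZ s" using s by (simp add: ballZ_def)
    qed
    then show ?thesis using Oloc_mono[OF finite_ballZ, of X s] X by blast
  qed
  then show ?thesis by (rule that)
qed

text \<open>The charge represented by the class of a Cauchy sequence \<open>a\<close> is realised by block sums of translates of
  \<open>a\<close>, where the index into \<open>a\<close> grows so slowly with the block size that each block sum already
  behaves like its infinite-volume limit.\<close>
lemma hform_in_Qstar:
  assumes h: "h \<in> completion fs (Obs Oloc)"
  shows "(\<lambda>B. if B \<in> Obs Oloc then hform fs h B else 0) \<in> Qstar sc star Oloc iota \<omega>"
proof -
  define a where "a = form.rep h"
  have fc: "fcauchy fs (Obs Oloc) a" unfolding a_def by (rule form.rep_mem(1)[OF h])
  then have a: "a j \<in> Obs Oloc" for j by (simp add: fcauchy_def)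
  obtain M where M: "\<And>n. form.sn (a n) \<le> M" "M > 0" using form.fcauchy_bounded[OF fc] by blast
  \<comment> \<open>The block cube has half-side \<open>2 * u n\<close>, hence l1 radius at most
    \<open>n / 2\<close>; the other half of \<open>n\<close> is left for the support of
    \<open>a j\<close>.\<close>
  define u where "u n = n div (4 * CARD('d))" for n :: nat
  \<comment> \<open>The half-side is twice \<open>u n\<close> so that, for \<open>y\<close> with
    coordinates at most \<open>u n\<close>, the differences \<open>y - x\<close> still cover
    \<open>cube (u n)\<close>. The matching \<open>k\<close> below makes the coordinates in
    \<open>ballZ (k * n)\<close> at most \<open>u n\<close>.\<close>
  define blk where "blk A n = (\<Sum>x\<in>cube (2 * u n). iota x A)" for A n
  define c where "c n = real (card (cube (2 * u n) :: (int^'d) set))" for n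
  define k :: real where "k = 1 / (4 * real CARD('d))"
  define loc where "loc j n \<longleftrightarrow> a j \<in> Oloc (ballZ (real n / 2))" for j n
  define var where "var j n \<longleftrightarrow> Re (cs (blk (a j) n) (blk (a j) n)) \<le> c n * (Re (fs (a j) (a j)) + 1)" for j n
  \<comment> \<open>Quantifying over all observables in a ball of radius \<open>j\<close> leaves a
    condition on \<open>j\<close> and \<open>n\<close> alone, as \<open>slow_diagonal\<close>
    requires; every fixed observable enters that ball as \<open>j\<close> grows.\<close>
  define trunc where "trunc j n \<longleftrightarrow> (\<forall>B\<in>Oloc (ballZ (real j)). \<forall>T. finite T \<longrightarrow> cube (u n) \<subseteq> T \<longrightarrow>
      cmod (fs (a j) B - (\<Sum>z\<in>T. cs (a j) (iota z B))) \<le> 1 / (real j + 1) * norm B)" for j n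
  have D: "4 * CARD('d) > 0" by simp
  have u_le: "4 * CARD('d) * u n \<le> n" for n unfolding u_def by simp
  have u_lim: "filterlim u at_top sequentially"
    unfolding filterlim_at_top
  proof
    fix Z
    show "\<forall>\<^sub>F n in sequentially. Z \<le> u n"
    proof (rule eventually_sequentiallyI[of "Z * (4 * CARD('d))"])
      fix n assume "Z * (4 * CARD('d)) \<le> n"
      then show "Z \<le> u n" unfolding u_def using less_eq_div_iff_mult_less_eq[OF D] by simp
    qed
  qed
  have u2_lim: "filterlim (\<lambda>n. 2 * u n) at_top sequentially"
    by (rule filterlim_at_top_mono[OF u_lim]) simp
  have c: "c n > 0" for n unfolding c_def card_cube by (intro zero_less_power) simp
  have ev: "\<forall>\<^sub>F n in sequentially. loc j n \<and> var j n \<and> trunc j n" for j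
  proof (intro eventually_conj)
    obtain r where r: "\<And>s. s \<ge> real r \<Longrightarrow> a j \<in> Oloc (ballZ s)" using Obs_in_ball[OF a] by blast
    show "\<forall>\<^sub>F n in sequentially. loc j n"
      by (rule eventually_sequentiallyI[of "2 * r"]) (auto simp: loc_def intro!: r)
    have "(\<lambda>n. Re (cs (blk (a j) n) (blk (a j) n) / of_nat (card (cube (2 * u n) :: (int^'d) set)))) \<longlonglongrightarrow> Re (fs (a j) (a j))"
      unfolding blk_def by (intro tendsto_Re filterlim_compose[OF cube_average_form[OF a a] u2_lim])
    then have "\<forall>\<^sub>F n in sequentially. Re (cs (blk (a j) n) (blk (a j) n) / of_nat (card (cube (2 * u n) :: (int^'d) set))) < Re (fs (a j) (a j)) + 1"
      by (rule order_tendstoD) simp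
    then show "\<forall>\<^sub>F n in sequentially. var j n"
    proof (rule eventually_mono)
      fix n assume "Re (cs (blk (a j) n) (blk (a j) n) / of_nat (card (cube (2 * u n) :: (int^'d) set))) < Re (fs (a j) (a j)) + 1"
      then have "Re (cs (blk (a j) n) (blk (a j) n)) / c n < Re (fs (a j) (a j)) + 1" by (simp add: c_def Re_divide_of_nat)
      then show "var j n" unfolding var_def using c[of n] by (simp add: pos_divide_less_eq mult.commute less_imp_le)
    qed
    have "1 / (real j + 1) > 0" by simp
    from form_truncation[OF a finite_ballZ this] obtain N where N: "\<forall>B\<in>Oloc (ballZ (real j)). \<forall>T. finite T \<longrightarrow> cube N \<subseteq> T \<longrightarrow>
        cmod (fs (a j) B - (\<Sum>z\<in>T. cs (a j) (iota z B))) \<le> 1 / (real j + 1) * norm B" ..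
    have "\<forall>\<^sub>F n in sequentially. N \<le> u n" using u_lim by (simp add: filterlim_at_top)
    then show "\<forall>\<^sub>F n in sequentially. trunc j n"
    proof (rule eventually_mono)
      fix n assume "N \<le> u n"
      then show "trunc j n" unfolding trunc_def using N cube_mono[of N "u n"] by (meson order_trans)
    qed
  qed
  obtain J where J: "filterlim J at_top sequentially"
    and PJ: "\<forall>\<^sub>F n in sequentially. loc (J n) n \<and> var (J n) n \<and> trunc (J n) n"
    using slow_diagonal[of "\<lambda>j n. loc j n \<and> var j n \<and> trunc j n"] ev by blast
  \<comment> \<open>Localisation and the variance bound are demanded at every \<open>n\<close>,
    while \<open>loc\<close> and \<open>var\<close> hold only eventually; the default 0 satisfies
    both. \<open>trunc\<close> is used for limits only and stays out of the test.\<close>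
  define R where "R n = (if loc (J n) n \<and> var (J n) n then blk (a (J n)) n else 0)" for n
  define Q where "Q n = star (R n)" for n
  have loc_blk: "R n \<in> Oloc (ballZ (real n))" for n
  proof (cases "loc (J n) n \<and> var (J n) n")
    case True
    have "iota x (a (J n)) \<in> Oloc (ballZ (real n))" if x: "x \<in> cube (2 * u n)" for x
    proof -
      have "(\<lambda>y. y + x) ` ballZ (real n / 2) \<subseteq> ballZ (real n)"
      proof (rule image_subsetI)
        fix y :: "int^'d" assume y: "y \<in> ballZ (real n / 2)"
        have "l1dist x 0 \<le> int (CARD('d) * (2 * u n))" by (rule l1_cube[OF x])
        then have "real_of_int (l1dist x 0) \<le> real_of_int (int (CARD('d) * (2 * u n)))" by (simp only: of_int_le_iff)
        also have "\<dots> \<le> real n / 2"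
        proof -
          have "real (4 * CARD('d) * u n) \<le> real n" using u_le[of n] by (simp only: of_nat_le_iff)
          then show ?thesis by simp
        qed
        finally have x2: "real_of_int (l1dist x 0) \<le> real n / 2" .
        have "l1dist (y + x) 0 \<le> l1dist y 0 + l1dist x 0"
          unfolding l1dist_def sum.distrib[symmetric] by (rule sum_mono) auto
        then have "real_of_int (l1dist (y + x) 0) \<le> real_of_int (l1dist y 0 + l1dist x 0)" by (simp only: of_int_le_iff)
        then show "y + x \<in> ballZ (real n)" using x2 y by (simp add: ballZ_def)
      qed
      then show ?thesis using iota_Oloc[OF finite_ballZ, of "a (J n)" "real n / 2" x] True Oloc_mono[OF finite_ballZ]
        unfolding loc_def by blast
    qed
    then have "blk (a (J n)) n \<in> Oloc (ballZ (real n))" unfolding blk_def by (intro Oloc_sum finite_ballZ)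
    then show ?thesis using True by (simp add: R_def)
  next
    case False
    then show ?thesis unfolding R_def by (auto simp: Oloc_0)
  qed
  \<comment> \<open>The block side \<open>4 * u n + 1\<close> is at most \<open>2 * n\<close>,
    \<open>M\<close> bounds the seminorms along \<open>a\<close>, and the 1 is the slack in
    \<open>var\<close>.\<close>
  define \<gamma> where "\<gamma> = 2 ^ CARD('d) * (M\<^sup>2 + 1)"
  have "M\<^sup>2 + 1 > 0" by (intro add_nonneg_pos) auto
  then have \<gamma>0: "\<gamma> > 0" by (simp add: \<gamma>_def)
  have I: "Re (cs (R n) (R n)) \<le> \<gamma> * real n ^ CARD('d)" if n: "n > 0" for n
  proof (cases "loc (J n) n \<and> var (J n) n")
    case True
    then have "Re (cs (R n) (R n)) \<le> c n * (Re (fs (a (J n)) (a (J n))) + 1)" by (simp add: R_def var_def)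
    also have "\<dots> \<le> (2 * real n) ^ CARD('d) * (M\<^sup>2 + 1)"
    proof (rule mult_mono)
      have "4 * u n \<le> 4 * CARD('d) * u n" using mult_le_mono1[of 1 "CARD('d)" "4 * u n"] by (simp add: mult_ac Suc_le_eq)
      then have "4 * u n + 1 \<le> 2 * n" using u_le[of n] n by linarith
      then have "real (4 * u n + 1) \<le> real (2 * n)" by (simp only: of_nat_le_iff)
      then have "2 * real (2 * u n) + 1 \<le> 2 * real n" by simp
      then show "c n \<le> (2 * real n) ^ CARD('d)" unfolding c_def card_cube by (intro power_mono) auto
      have "(form.sn (a (J n)))\<^sup>2 \<le> M\<^sup>2" using M form.sn_ge0[OF a] by (intro power_mono) auto
      then show "Re (fs (a (J n)) (a (J n))) + 1 \<le> M\<^sup>2 + 1" by (simp add: form.sn_sq a)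
      show "0 \<le> Re (fs (a (J n)) (a (J n))) + 1" using form.pos[OF a[of "J n"]] by linarith
    qed simp
    also have "\<dots> = \<gamma> * real n ^ CARD('d)" by (simp add: \<gamma>_def power_mult_distrib)
    finally show ?thesis .
  next
    case False
    then have "R n = 0" unfolding R_def by (rule if_not_P)
    then show ?thesis using \<gamma>0 by (simp add: cov.zero_right)
  qed
  \<comment> \<open>One estimate for two conditions: \<open>y = 0\<close> gives convergence, and
    uniformity in \<open>y\<close> gives almost-invariance.\<close>
  have close: "\<forall>\<^sub>F n in sequentially. \<forall>y\<in>ballZ (k * real n). cmod (fs (a (J n)) B - cs (R n) (iota y B)) \<le> 1 / (real (J n) + 1) * norm B"
    if B: "B \<in> Obs Oloc" for B
  proof -
    obtain r where r: "\<And>s. s \<ge> real r \<Longrightarrow> B \<in> Oloc (ballZ s)" using Obs_in_ball[OF B] by blast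
    have "\<forall>\<^sub>F n in sequentially. r \<le> J n" using J by (simp add: filterlim_at_top)
    with PJ show ?thesis
    proof eventually_elim
      case (elim n)
      show ?case
      proof
        fix y :: "int^'d" assume y: "y \<in> ballZ (k * real n)"
        have yc: "\<bar>y $ i\<bar> \<le> int (u n)" for i
        proof -
          have "real_of_int (l1dist y 0) \<le> real n / real (4 * CARD('d))" using y by (simp add: ballZ_def k_def)
          then have "l1dist y 0 \<le> \<lfloor>real n / real (4 * CARD('d))\<rfloor>" by (simp only: le_floor_iff)
          also have "\<dots> = int (u n)" unfolding u_def by (rule floor_divide_of_nat_eq)
          finally show ?thesis using abs_le_l1[of y i] by simp
        qed
        define T where "T = (\<lambda>x. y - x) ` cube (2 * u n)"
        have "cube (u n) \<subseteq> T"
        proof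
          fix z :: "int^'d" assume z: "z \<in> cube (u n)"
          have "\<bar>(y - z) $ i\<bar> \<le> int (2 * u n)" for i
          proof -
            have "\<bar>z $ i\<bar> \<le> int (u n)" using z by (simp add: cube_def)
            then show ?thesis using yc[of i] by simp
          qed
          then have "y - z \<in> cube (2 * u n)" by (simp add: cube_def)
          then show "z \<in> T" unfolding T_def by (rule rev_image_eqI) simp
        qed
        moreover have "finite T" by (simp add: T_def)
        moreover have "cs (R n) (iota y B) = (\<Sum>z\<in>T. cs (a (J n)) (iota z B))"
        proof -
          have "(\<Sum>z\<in>T. cs (a (J n)) (iota z B)) = (\<Sum>x\<in>cube (2 * u n). cs (a (J n)) (iota (y - x) B))"
            unfolding T_def by (subst sum.reindex) (auto simp: inj_on_def)
          also have "\<dots> = cs (blk (a (J n)) n) (iota y B)" by (simp add: blk_def cov.sum_left cs_iota_diff)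
          finally show ?thesis using elim by (simp add: R_def)
        qed
        moreover have "B \<in> Oloc (ballZ (real (J n)))" using r elim by simp
        ultimately show "cmod (fs (a (J n)) B - cs (R n) (iota y B)) \<le> 1 / (real (J n) + 1) * norm B"
          using elim unfolding trunc_def by simp
      qed
    qed
  qed
  have inv_lim: "(\<lambda>n. 1 / (real (J n) + 1) * x) \<longlonglongrightarrow> 0" for x
  proof -
    have "(\<lambda>n. 1 / (real n + 1)) \<longlonglongrightarrow> 0" using LIMSEQ_Suc[OF lim_1_over_n] by (simp add: add.commute)
    from tendsto_mult_left_zero[OF filterlim_compose[OF this J]] show ?thesis .
  qed
  have "real CARD('d) \<ge> 1" using D by (simp add: Suc_le_eq)
  then have "1 < 4 * real CARD('d)" by linarith
  then have k: "0 < k" "k < 1" by (auto simp: k_def)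
  have ball0: "0 \<in> ballZ (k * real n)" for n using k by (intro zero_in_ballZ) simp
  have limR: "(\<lambda>n. cs (R n) B) \<longlonglongrightarrow> hform fs h B" if B: "B \<in> Obs Oloc" for B
  proof -
    have "(\<lambda>j. fs (a j) B) \<longlonglongrightarrow> hform fs h B" unfolding a_def by (rule form.hform_tendsto[OF h B])
    then have 1: "(\<lambda>n. fs (a (J n)) B) \<longlonglongrightarrow> hform fs h B" using J by (rule filterlim_compose)
    have "\<forall>\<^sub>F n in sequentially. cmod (fs (a (J n)) B - cs (R n) B) \<le> 1 / (real (J n) + 1) * norm B"
      using close[OF B] by (rule eventually_mono) (use ball0 iota_0 in metis)
    then have "(\<lambda>n. fs (a (J n)) B - cs (R n) B) \<longlonglongrightarrow> 0" using inv_lim by (rule Lim_null_comparison)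
    from tendsto_diff[OF 1 this] show ?thesis by simp
  qed
  have Q\<omega>: "\<omega> (star (centered sc \<omega> (Q n)) * iota x A) = cnj (cs (R n) (iota x (star A)))" for n x A
    by (simp add: \<omega>_centered Q_def star_star iota_star)
  have Q\<omega>0: "\<omega> (star (centered sc \<omega> (Q n)) * A) = cnj (cs (R n) (star A))" for n A
    by (simp add: \<omega>_centered Q_def star_star)
  have pl: "pseudolocal sc star Oloc iota \<omega> Q"
    unfolding pseudolocal_def
  proof (intro conjI allI ballI)
    show "Q n \<in> Oloc (ballZ (real n))" for n unfolding Q_def by (rule Oloc_star[OF finite_ballZ loc_blk])
    show "\<exists>\<gamma>>0. \<forall>n>0. Re (\<omega> (star (centered sc \<omega> (Q n)) * centered sc \<omega> (Q n))) \<le> \<gamma> * real n ^ CARD('d)"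
      using \<gamma>0 I by (auto simp: \<omega>_centered_sq Q_def star_star)
    show "convergent (\<lambda>n. \<omega> (star (centered sc \<omega> (Q n)) * A))" if "A \<in> Obs Oloc" for A
      unfolding Q\<omega>0 convergent_def using tendsto_cnj[OF limR[OF Obs_star[OF that]]] by blast
    have "(\<lambda>n. Max ((\<lambda>(x, y). cmod (\<omega> (star (centered sc \<omega> (Q n)) * iota x A) - \<omega> (star (centered sc \<omega> (Q n)) * iota y A)))
                      ` (ballZ (k * real n) \<times> ballZ (k * real n)))) \<longlonglongrightarrow> 0" if A: "A \<in> Obs Oloc" for A
    proof (rule Lim_null_comparison[OF _ inv_lim[of "2 * norm (star A)"]])
      show "\<forall>\<^sub>F n in sequentially. norm (Max ((\<lambda>(x, y). cmod (\<omega> (star (centered sc \<omega> (Q n)) * iota x A) - \<omega> (star (centered sc \<omega> (Q n)) * iota y A)))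
                      ` (ballZ (k * real n) \<times> ballZ (k * real n)))) \<le> 1 / (real (J n) + 1) * (2 * norm (star A))"
        using close[OF Obs_star[OF A]]
      proof (rule eventually_mono)
        fix n
        let ?E = "(\<lambda>(x, y). cmod (\<omega> (star (centered sc \<omega> (Q n)) * iota x A) - \<omega> (star (centered sc \<omega> (Q n)) * iota y A)))
                      ` (ballZ (k * real n) \<times> ballZ (k * real n))"
        let ?b = "1 / (real (J n) + 1) * norm (star A)"
        assume cl: "\<forall>y\<in>ballZ (k * real n). cmod (fs (a (J n)) (star A) - cs (R n) (iota y (star A))) \<le> ?b"
        have "Max ?E \<in> ?E" by (rule Max_in) (use ball0[of n] in auto)
        then obtain x y where xy: "x \<in> ballZ (k * real n)" "y \<in> ballZ (k * real n)"
          and E: "Max ?E = cmod (\<omega> (star (centered sc \<omega> (Q n)) * iota x A) - \<omega> (star (centered sc \<omega> (Q n)) * iota y A))" by auto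
        \<comment> \<open>Both sites are compared with the same site-independent value of the form,
          which doubles the error.\<close>
        have "\<omega> (star (centered sc \<omega> (Q n)) * iota x A) - \<omega> (star (centered sc \<omega> (Q n)) * iota y A)
           = cnj ((fs (a (J n)) (star A) - cs (R n) (iota y (star A))) - (fs (a (J n)) (star A) - cs (R n) (iota x (star A))))"
          by (simp add: Q\<omega>)
        then have "Max ?E = cmod ((fs (a (J n)) (star A) - cs (R n) (iota y (star A))) - (fs (a (J n)) (star A) - cs (R n) (iota x (star A))))"
          unfolding E by (simp only: complex_mod_cnj)
        also have "\<dots> \<le> ?b + ?b"
          by (rule order_trans[OF norm_triangle_ineq4 add_mono[OF bspec[OF cl xy(2)] bspec[OF cl xy(1)]]])
        finally have "Max ?E \<le> 1 / (real (J n) + 1) * (2 * norm (star A))" by simp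
        moreover have "Max ?E \<ge> 0" unfolding E by simp
        ultimately show "norm (Max ?E) \<le> 1 / (real (J n) + 1) * (2 * norm (star A))" by (simp only: real_norm_def abs_of_nonneg)
      qed
    qed
    then show "\<exists>k::real. 0 < k \<and> k < 1 \<and> (\<forall>A\<in>Obs Oloc.
           (\<lambda>n. Max ((\<lambda>(x, y). cmod (\<omega> (star (centered sc \<omega> (Q n)) * iota x A)
                                     - \<omega> (star (centered sc \<omega> (Q n)) * iota y A)))
                      ` (ballZ (k * real n) \<times> ballZ (k * real n)))) \<longlonglongrightarrow> 0)"
      using k by blast
  qed
  have "charge_star sc star Oloc \<omega> Q B = (if B \<in> Obs Oloc then hform fs h B else 0)" for B
  proof (cases "B \<in> Obs Oloc")
    case True
    have "(\<lambda>n. cs (R n) B) \<longlonglongrightarrow> charge_star sc star Oloc \<omega> Q B"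
      using charge_star_tendsto[OF pl True] by (simp add: Q_def star_star)
    then show ?thesis using limR[OF True] True LIMSEQ_unique by auto
  qed (simp add: charge_star_def)
  then have "(\<lambda>B. if B \<in> Obs Oloc then hform fs h B else 0) = charge_star sc star Oloc \<omega> Q" by auto
  then show ?thesis unfolding Qstar_def using pl by blast
qed

text \<open>The bijection is explicit in the direction from densities to charges. The value 0
  outside \<open>Obs Oloc\<close> repeats the convention in \<open>charge_star\<close>, so that the
  two agree as functions on the whole type.\<close>

lemma Qstar_bij:
  "bij_betw (\<lambda>h B. if B \<in> Obs Oloc then hform fs h B else 0) (completion fs (Obs Oloc)) (Qstar sc star Oloc iota \<omega>)"
  unfolding bij_betw_def
proof
  show "inj_on (\<lambda>h B. if B \<in> Obs Oloc then hform fs h B else 0) (completion fs (Obs Oloc))"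
  proof (rule inj_onI)
    fix h h' assume hh: "h \<in> completion fs (Obs Oloc)" "h' \<in> completion fs (Obs Oloc)"
      and eq: "(\<lambda>B. if B \<in> Obs Oloc then hform fs h B else 0) = (\<lambda>B. if B \<in> Obs Oloc then hform fs h' B else 0)"
    have "hform fs h B = hform fs h' B" if "B \<in> Obs Oloc" for B using fun_cong[OF eq, of B] that by simp
    then show "h = h'" by (rule form.hform_inj[OF hh])
  qed
  show "(\<lambda>h B. if B \<in> Obs Oloc then hform fs h B else 0) ` completion fs (Obs Oloc) = Qstar sc star Oloc iota \<omega>"
  proof (intro equalityI subsetI)
    fix q assume "q \<in> (\<lambda>h B. if B \<in> Obs Oloc then hform fs h B else 0) ` completion fs (Obs Oloc)"
    then show "q \<in> Qstar sc star Oloc iota \<omega>" using hform_in_Qstar by auto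
  next
    fix q assume "q \<in> Qstar sc star Oloc iota \<omega>"
    then obtain Q where Q: "q = charge_star sc star Oloc \<omega> Q" "pseudolocal sc star Oloc iota \<omega> Q"
      unfolding Qstar_def by blast
    obtain K where K: "form.bounded_functional q K" using charge_star_bounded[OF Q(2)] Q(1) by blast
    obtain h where h: "h \<in> completion fs (Obs Oloc)" "\<And>B. B \<in> Obs Oloc \<Longrightarrow> q B = hform fs h B"
      using form.Riesz[OF K] by blast
    have "q = (\<lambda>B. if B \<in> Obs Oloc then hform fs h B else 0)"
    proof
      fix B show "q B = (if B \<in> Obs Oloc then hform fs h B else 0)"
        by (cases "B \<in> Obs Oloc") (auto simp: h(2), simp add: Q(1) charge_star_def)
    qed
    then show "q \<in> (\<lambda>h B. if B \<in> Obs Oloc then hform fs h B else 0) ` completion fs (Obs Oloc)"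
      using h(1) by (rule image_eqI)
  qed
qed

end

theorem theorem5p6:
  fixes sc :: "complex \<Rightarrow> 'a::{real_normed_algebra_1,banach} \<Rightarrow> 'a"
    and star :: "'a \<Rightarrow> 'a"
    and Oloc :: "(int^'d) set \<Rightarrow> 'a set"
    and iota :: "int^'d \<Rightarrow> 'a \<Rightarrow> 'a"
    and \<omega> :: "'a \<Rightarrow> complex"
  assumes "lattice_setting sc star Oloc iota"
    and "clustering_state sc star Oloc iota \<omega>"
  shows "\<exists>\<DD>. bij_betw \<DD> (Qstar sc star Oloc iota \<omega>) (Hstar sc star Oloc iota \<omega>) \<and>
           (\<forall>q\<in>Qstar sc star Oloc iota \<omega>. \<forall>A\<in>Obs Oloc.
              q A = hform (form_star star iota \<omega>) (\<DD> q) A) \<and>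
           (\<forall>q\<in>Qstar sc star Oloc iota \<omega>. \<exists>L.
              (\<forall>A\<in>Obs Oloc. L (emb (form_star star iota \<omega>) (Obs Oloc) A) = q A) \<and>
              (\<forall>h\<in>Hstar sc star Oloc iota \<omega>. \<forall>k\<in>Hstar sc star Oloc iota \<omega>.
                 L (hadd (form_star star iota \<omega>) (Obs Oloc) h k) = L h + L k) \<and>
              (\<forall>c. \<forall>h\<in>Hstar sc star Oloc iota \<omega>.
                 L (hscale sc (form_star star iota \<omega>) (Obs Oloc) c h) = c * L h) \<and>
              (\<exists>C. \<forall>h\<in>Hstar sc star Oloc iota \<omega>.
                 cmod (L h) \<le> C * hnorm (form_star star iota \<omega>) h))"
proof -
  interpret clustering_lattice sc star Oloc iota \<omega> using assms by unfold_locales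
  let ?\<Phi> = "\<lambda>h B. if B \<in> Obs Oloc then hform fs h B else 0"
  define \<DD> where "\<DD> = inv_into (completion fs (Obs Oloc)) ?\<Phi>"
  have H: "Hstar sc star Oloc iota \<omega> = completion fs (Obs Oloc)" by (simp add: Hstar_def)
  have "bij_betw \<DD> (Qstar sc star Oloc iota \<omega>) (Hstar sc star Oloc iota \<omega>)"
    unfolding \<DD>_def H by (rule bij_betw_inv_into[OF Qstar_bij])
  moreover have "q A = hform fs (\<DD> q) A" if q: "q \<in> Qstar sc star Oloc iota \<omega>" and A: "A \<in> Obs Oloc" for q A
  proof -
    have "?\<Phi> (\<DD> q) = q" unfolding \<DD>_def by (rule bij_betw_inv_into_right[OF Qstar_bij q])
    from fun_cong[OF this, of A] show ?thesis using A by simp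
  qed
  moreover have "\<exists>L. (\<forall>A\<in>Obs Oloc. L (emb fs (Obs Oloc) A) = q A) \<and>
              (\<forall>h\<in>Hstar sc star Oloc iota \<omega>. \<forall>k\<in>Hstar sc star Oloc iota \<omega>. L (hadd fs (Obs Oloc) h k) = L h + L k) \<and>
              (\<forall>c. \<forall>h\<in>Hstar sc star Oloc iota \<omega>. L (hscale sc fs (Obs Oloc) c h) = c * L h) \<and>
              (\<exists>C. \<forall>h\<in>Hstar sc star Oloc iota \<omega>. cmod (L h) \<le> C * hnorm fs h)"
    if q: "q \<in> Qstar sc star Oloc iota \<omega>" for q
  proof -
    obtain K where "form.bounded_functional q K" using q charge_star_bounded unfolding Qstar_def by blast
    then show ?thesis unfolding H by (rule form.extension_exists)
  qed
  ultimately show ?thesis by blast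
qed

end
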